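(* Let $d,n\in\mathbb{N}$ and $\alpha,\varepsilon\in(0,1)$. Let $\mathcal{D}_0$ be the distribution of $(X_1,\dots,X_n)$ with $X_i$ i.i.d. $\mathcal{N}(0,I_d)$, and let $\mathcal{D}_1$ be the distribution of $(X_1,\dots,X_n)$ obtained by first drawing $v\sim\mathcal{N}(0,\frac1d I_d)$ and then, conditionally on $v$, drawing each $X_i$ i.i.d. from the mixture $(1-\varepsilon)\,\mathcal{N}(\alpha v,I_d)+\varepsilon\,\mathcal{N}\!\left(-\frac{1-\varepsilon}{\varepsilon}\alpha v,I_d\right)$. Then there exists a small absolute constant $c>0$ such that if $n=c\cdot\frac{d\varepsilon^3}{\alpha^4}$, $\alpha\ge\varepsilon$, and $c\cdot\frac{d\varepsilon^3}{\alpha^4}\ge\frac{\sqrt d}{\alpha^2}$, then $d_{TV}(\mathcal{D}_0,\mathcal{D}_1)\le 0.1$.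
   Context: $d_{TV}$ denotes total variation distance. *)

theory Defs
  imports "HOL-Probability.Probability"
begin

text \<open>
  Vectors of \<open>\<real>\<^sup>d\<close> are functions on the index set \<open>{..<d}\<close> (extensional elements of
  the product space), so that the dimension can be quantified inside a formula.
\<close>

text \<open>The law \<open>N(\<mu>, s I\<^sub>d)\<close>; the third argument \<open>s\<close> is the variance, whereas
  \<^const>\<open>normal_density\<close> expects the standard deviation.\<close>

definition gaussian_iso :: "nat \<Rightarrow> (nat \<Rightarrow> real) \<Rightarrow> real \<Rightarrow> (nat \<Rightarrow> real) measure" where
  "gaussian_iso d \<mu> s = (\<Pi>\<^sub>M i\<in>{..<d}. density lborel (normal_density (\<mu> i) (sqrt s)))"

text \<open>The mixture \<open>(1 - p) P + p Q\<close> of two laws on the same measurable space.\<close>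

definition mixture :: "real \<Rightarrow> 'a measure \<Rightarrow> 'a measure \<Rightarrow> 'a measure" where
  "mixture p P Q = measure_of (space P) (sets P)
     (\<lambda>A. ennreal (1 - p) * emeasure P A + ennreal p * emeasure Q A)"

definition iid :: "nat \<Rightarrow> 'a measure \<Rightarrow> (nat \<Rightarrow> 'a) measure" where
  "iid n P = (\<Pi>\<^sub>M i\<in>{..<n}. P)"

definition tv_dist :: "'a measure \<Rightarrow> 'a measure \<Rightarrow> real" where
  "tv_dist P Q = (SUP A\<in>sets P. \<bar>measure P A - measure Q A\<bar>)"

definition null_dist :: "nat \<Rightarrow> nat \<Rightarrow> (nat \<Rightarrow> nat \<Rightarrow> real) measure" where
  "null_dist d n = iid n (gaussian_iso d (\<lambda>_. 0) 1)"

definition sample_mixture :: "nat \<Rightarrow> real \<Rightarrow> real \<Rightarrow> (nat \<Rightarrow> real) \<Rightarrow> (nat \<Rightarrow> real) measure" where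
  "sample_mixture d \<alpha> \<epsilon> v =
     mixture \<epsilon> (gaussian_iso d (\<lambda>i. \<alpha> * v i) 1)
               (gaussian_iso d (\<lambda>i. - ((1 - \<epsilon>) / \<epsilon>) * \<alpha> * v i) 1)"

definition planted_dist :: "nat \<Rightarrow> nat \<Rightarrow> real \<Rightarrow> real \<Rightarrow> (nat \<Rightarrow> nat \<Rightarrow> real) measure" where
  "planted_dist d n \<alpha> \<epsilon> =
     gaussian_iso d (\<lambda>_. 0) (1 / real d) \<bind> (\<lambda>v. iid n (sample_mixture d \<alpha> \<epsilon> v))"

text \<open>
  Well-definedness: the set function in \<^const>\<open>mixture\<close> is a measure and the kernel in
  \<^const>\<open>planted_dist\<close> is measurable, so neither \<^const>\<open>measure_of\<close> nor
  \<^const>\<open>bind\<close> falls back to a default value.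
\<close>

lemma sets_mixture [simp]: "sets (mixture p P Q) = sets P"
  and space_mixture [simp]: "space (mixture p P Q) = space P"
  by (simp_all add: mixture_def)

lemma emeasure_mixture:
  assumes "sets Q = sets P" "A \<in> sets P"
  shows "emeasure (mixture p P Q) A = ennreal (1 - p) * emeasure P A + ennreal p * emeasure Q A"
  unfolding mixture_def
proof (rule emeasure_measure_of_sigma)
  show "sigma_algebra (space P) (sets P)" ..
  show "positive (sets P) (\<lambda>A. ennreal (1 - p) * emeasure P A + ennreal p * emeasure Q A)"
    by (simp add: positive_def)
  show "countably_additive (sets P)
      (\<lambda>A. ennreal (1 - p) * emeasure P A + ennreal p * emeasure Q A)"
  proof (rule countably_additiveI)
    fix F :: "nat \<Rightarrow> 'a set"
    assume F: "range F \<subseteq> sets P" "disjoint_family F"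
    then show "(\<Sum>i. ennreal (1 - p) * emeasure P (F i) + ennreal p * emeasure Q (F i)) =
        ennreal (1 - p) * emeasure P (\<Union>i. F i) + ennreal p * emeasure Q (\<Union>i. F i)"
      using assms(1) by (simp add: suminf_add[symmetric] suminf_emeasure)
  qed
qed (use assms in auto)

lemma prob_space_mixture:
  assumes "prob_space P" "prob_space Q" "sets Q = sets P" "0 \<le> p" "p \<le> 1"
  shows "prob_space (mixture p P Q)"
proof
  have "emeasure P (space P) = 1" "emeasure Q (space P) = 1"
    using assms(1,2) sets_eq_imp_space_eq[OF assms(3)] prob_space.emeasure_space_1 by metis+
  then show "emeasure (mixture p P Q) (space (mixture p P Q)) = 1"
    using assms(4,5) by (simp add: emeasure_mixture[OF assms(3)] flip: ennreal_plus)
qed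

lemma measurable_mixture:
  assumes K: "K \<in> M \<rightarrow>\<^sub>M prob_algebra N" and L: "L \<in> M \<rightarrow>\<^sub>M prob_algebra N"
    and p: "0 \<le> p" "p \<le> 1"
  shows "(\<lambda>x. mixture p (K x) (L x)) \<in> M \<rightarrow>\<^sub>M prob_algebra N"
proof (rule measurable_prob_algebraI)
  have *: "prob_space (K x)" "sets (K x) = sets N" "prob_space (L x)" "sets (L x) = sets N"
    if "x \<in> space M" for x
    using measurable_space[OF K that] measurable_space[OF L that]
    by (auto simp: space_prob_algebra)
  show pr: "prob_space (mixture p (K x) (L x))" if "x \<in> space M" for x
    using *[OF that] p by (intro prob_space_mixture) auto
  show "(\<lambda>x. mixture p (K x) (L x)) \<in> M \<rightarrow>\<^sub>M subprob_algebra N"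
  proof (rule measurable_subprob_algebra)
    fix A assume A: "A \<in> sets N"
    note [measurable] = measurable_prob_algebraD[OF K] measurable_prob_algebraD[OF L] A
    have "(\<lambda>x. ennreal (1 - p) * emeasure (K x) A + ennreal p * emeasure (L x) A)
        \<in> borel_measurable M"
      by measurable
    then show "(\<lambda>x. emeasure (mixture p (K x) (L x)) A) \<in> borel_measurable M"
      using * A by (subst measurable_cong[OF emeasure_mixture]) auto
  qed (use * pr in \<open>auto intro: prob_space_imp_subprob_space\<close>)
qed

lemma measurable_PiM_kernel:
  assumes I: "finite I" and K: "\<And>i. i \<in> I \<Longrightarrow> K i \<in> M \<rightarrow>\<^sub>M prob_algebra (N i)"
  shows "(\<lambda>x. \<Pi>\<^sub>M i\<in>I. K i x) \<in> M \<rightarrow>\<^sub>M prob_algebra (\<Pi>\<^sub>M i\<in>I. N i)"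
proof (rule measurable_prob_algebra_generated[OF sets_PiM Int_stable_prod_algebra
      prod_algebra_sets_into_space])
  have *: "prob_space (K i x)" "sets (K i x) = sets (N i)" if "x \<in> space M" "i \<in> I" for x i
    using measurable_space[OF K[OF that(2)] that(1)] by (auto simp: space_prob_algebra)
  show "prob_space (\<Pi>\<^sub>M i\<in>I. K i x)" if "x \<in> space M" for x
    using *[OF that] by (intro prob_space_PiM) auto
  show "sets (\<Pi>\<^sub>M i\<in>I. K i x) = sets (\<Pi>\<^sub>M i\<in>I. N i)" if "x \<in> space M" for x
    using *[OF that] by (intro sets_PiM_cong) auto
  fix A assume "A \<in> prod_algebra I N"
  then obtain E where E: "A = Pi\<^sub>E I E" "E \<in> (\<Pi> i\<in>I. sets (N i))"
    by (rule prod_algebraE_all)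
  have "emeasure (\<Pi>\<^sub>M i\<in>I. K i x) A = (\<Prod>i\<in>I. emeasure (K i x) (E i))"
    if x: "x \<in> space M" for x
  proof -
    define K' where "K' i = (if i \<in> I then K i x else return (count_space UNIV) undefined)" for i
    interpret PK: product_prob_space K' I
      by (intro product_prob_spaceI) (auto simp: K'_def *[OF x] prob_space_return)
    have "(\<Pi>\<^sub>M i\<in>I. K i x) = PiM I K'"
      by (intro PiM_cong) (auto simp: K'_def)
    then show ?thesis
      using E * x I PK.emeasure_PiM[of I E] by (auto simp: K'_def Pi_iff)
  qed
  moreover have "(\<lambda>x. \<Prod>i\<in>I. emeasure (K i x) (E i)) \<in> borel_measurable M"
  proof (rule borel_measurable_prod_ennreal)
    fix i assume i: "i \<in> I"
    then have [measurable]: "E i \<in> sets (N i)" using E by auto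
    note [measurable] = measurable_prob_algebraD[OF K[OF i]]
    show "(\<lambda>x. emeasure (K i x) (E i)) \<in> borel_measurable M" by measurable
  qed
  ultimately show "(\<lambda>x. emeasure (\<Pi>\<^sub>M i\<in>I. K i x) A) \<in> borel_measurable M"
    by (simp cong: measurable_cong)
qed

lemma measurable_normal_kernel:
  assumes "0 < \<sigma>" and [measurable]: "f \<in> borel_measurable M"
  shows "(\<lambda>x. density lborel (normal_density (f x) \<sigma>)) \<in> M \<rightarrow>\<^sub>M prob_algebra borel"
proof (rule measurable_prob_algebraI)
  show pr: "prob_space (density lborel (normal_density (f x) \<sigma>))" for x
    using assms(1) by (rule prob_space_normal_density)
  show "(\<lambda>x. density lborel (normal_density (f x) \<sigma>)) \<in> M \<rightarrow>\<^sub>M subprob_algebra borel"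
  proof (rule measurable_subprob_algebra)
    fix A :: "real set" assume [measurable]: "A \<in> sets borel"
    have "(\<lambda>x. \<integral>\<^sup>+y. ennreal (normal_density (f x) \<sigma> y) * indicator A y \<partial>lborel)
        \<in> borel_measurable M"
      unfolding normal_density_def by measurable
    then show "(\<lambda>x. emeasure (density lborel (normal_density (f x) \<sigma>)) A) \<in> borel_measurable M"
      by (simp add: emeasure_density)
  qed (auto intro: prob_space_imp_subprob_space pr)
qed

abbreviation vec_space :: "nat \<Rightarrow> (nat \<Rightarrow> real) measure" where
  "vec_space d \<equiv> \<Pi>\<^sub>M i\<in>{..<d}. borel"

lemma gaussian_iso_in_prob_algebra:
  assumes "0 < s"
  shows "gaussian_iso d \<mu> s \<in> space (prob_algebra (vec_space d))"
  using assms unfolding gaussian_iso_def space_prob_algebra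
  by (auto intro!: sets_PiM_cong prob_space_PiM prob_space_normal_density)

lemma measurable_sample_mixture:
  assumes "0 \<le> \<epsilon>" "\<epsilon> \<le> 1"
  shows "sample_mixture d \<alpha> \<epsilon> \<in> vec_space d \<rightarrow>\<^sub>M prob_algebra (vec_space d)"
  unfolding sample_mixture_def[abs_def] gaussian_iso_def
  by (intro measurable_mixture measurable_PiM_kernel measurable_normal_kernel
      borel_measurable_times borel_measurable_const measurable_component_singleton)
    (use assms in auto)

lemma measurable_iid_sample_mixture:
  assumes "0 \<le> \<epsilon>" "\<epsilon> \<le> 1"
  shows "(\<lambda>v. iid n (sample_mixture d \<alpha> \<epsilon> v))
    \<in> vec_space d \<rightarrow>\<^sub>M prob_algebra (iid n (vec_space d))"
  unfolding iid_def using assms by (intro measurable_PiM_kernel measurable_sample_mixture) auto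

lemma
  assumes "1 \<le> d" "0 \<le> \<epsilon>" "\<epsilon> \<le> 1"
  shows prob_space_planted_dist: "prob_space (planted_dist d n \<alpha> \<epsilon>)"
    and sets_planted_dist: "sets (planted_dist d n \<alpha> \<epsilon>) = sets (null_dist d n)"
    and emeasure_planted_dist: "A \<in> sets (null_dist d n) \<Longrightarrow>
      emeasure (planted_dist d n \<alpha> \<epsilon>) A =
        (\<integral>\<^sup>+v. emeasure (iid n (sample_mixture d \<alpha> \<epsilon> v)) A
          \<partial>gaussian_iso d (\<lambda>_. 0) (1 / real d))"
proof -
  have G: "gaussian_iso d (\<lambda>_. 0) (1 / real d) \<in> space (prob_algebra (vec_space d))"
    using assms by (intro gaussian_iso_in_prob_algebra) auto
  note K = measurable_iid_sample_mixture[OF assms(2,3), of n d \<alpha>]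
  have "sets (gaussian_iso d (\<lambda>_. 0) 1) = sets (vec_space d)"
    using gaussian_iso_in_prob_algebra[of 1 d] by (auto simp: space_prob_algebra)
  then have N: "sets (null_dist d n) = sets (iid n (vec_space d))"
    unfolding null_dist_def iid_def by (intro sets_PiM_cong) auto
  show "prob_space (planted_dist d n \<alpha> \<epsilon>)"
    unfolding planted_dist_def by (rule prob_space_bind'[OF G K])
  show "sets (planted_dist d n \<alpha> \<epsilon>) = sets (null_dist d n)"
    unfolding planted_dist_def N by (rule sets_bind'[OF G K])
  show "emeasure (planted_dist d n \<alpha> \<epsilon>) A =
        (\<integral>\<^sup>+v. emeasure (iid n (sample_mixture d \<alpha> \<epsilon> v)) A
          \<partial>gaussian_iso d (\<lambda>_. 0) (1 / real d))" if "A \<in> sets (null_dist d n)"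
    using that unfolding planted_dist_def N by (rule emeasure_bind_prob_algebra[OF G K])
qed

lemma prob_space_null_dist: "prob_space (null_dist d n)"
  using gaussian_iso_in_prob_algebra[of 1 d "\<lambda>_. 0"] unfolding null_dist_def iid_def
  by (intro prob_space_PiM) (auto simp: space_prob_algebra)

end

theory Submission
  imports Defs
begin

text \<open>
  Given \<open>v\<close>, the planted sample has labels \<open>b\<^sub>i\<close> and \<open>X\<^sub>i \<sim> N(s(b\<^sub>i) v, I)\<close>. The plain second moment of the
  likelihood ratio is too large because of atypical labelings, so only labelings with at most
  \<open>3 \<epsilon> n\<close> minority labels are kept; this discards mass at most \<open>exp (- \<epsilon> n)\<close>. For two labelings
  \<open>a, b\<close> with overlap \<open>m = \<Sum>\<^sub>i s(a\<^sub>i) s(b\<^sub>i)\<close>, averaging over independent \<open>v, w\<close> gives the cross moment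
  \<open>E exp (m \<langle>v, w\<rangle>) = (1 - m\<^sup>2 / d\<^sup>2) powr (- d / 2) \<le> exp (m\<^sup>2 / d)\<close>; typical labelings satisfy
  \<open>\<bar>m\<bar> \<le> 4 \<alpha>\<^sup>2 n / \<epsilon> \<le> 4 c d\<close>, so this is finite. Since \<open>m\<close> is a sum of \<open>n\<close> independent centred terms
  of variance at most \<open>\<alpha>\<^sup>4 / \<epsilon>\<^sup>2\<close>, bounded by \<open>\<alpha>\<^sup>2 / \<epsilon>\<^sup>2\<close>, it is subgaussian in the range where the bound
  on \<open>\<bar>m\<bar>\<close> puts us, and \<open>E exp (m\<^sup>2 / d)\<close> is close to 1.
\<close>

section \<open>Truncated second moments and total variation\<close>

text \<open>The function \<open>f\<close> is the density with respect to \<open>P\<close> of a part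
  of \<open>Q\<close>, so \<open>P A - Q A\<close> is at most the integral of \<open>1 - f\<close>
  over \<open>A\<close>, hence at most \<open>E \<bar>1 - f\<bar>\<close>. By Cauchy-Schwarz this is
  at most the root of \<open>E (1 - f)^2 = 1 - 2 E f + E f^2\<close>, which the mass and second
  moment bounds limit to \<open>2 * \<delta> + \<eta>\<close>.\<close>

lemma tv_dist_le_truncated_second_moment:
  assumes "prob_space P" "prob_space Q" and sets: "sets Q = sets P"
    and [measurable]: "f \<in> borel_measurable P"
    and le: "\<And>A. A \<in> sets P \<Longrightarrow> (\<integral>\<^sup>+x\<in>A. f x \<partial>P) \<le> emeasure Q A"
    and mass: "ennreal (1 - \<delta>) \<le> (\<integral>\<^sup>+x. f x \<partial>P)"
    and second: "(\<integral>\<^sup>+x. (f x)\<^sup>2 \<partial>P) \<le> ennreal (1 + \<eta>)"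
    and \<delta>: "0 \<le> \<delta>" "\<delta> \<le> 1" and \<eta>: "0 \<le> \<eta>"
  shows "tv_dist P Q \<le> sqrt (2 * \<delta> + \<eta>)"
proof -
  interpret P: prob_space P by fact
  interpret Q: prob_space Q by fact
  have space: "space Q = space P" using sets by (rule sets_eq_imp_space_eq)
  \<comment> \<open>The integral of \<open>f\<close> is dominated by the finite mass of
    \<open>Q\<close>, so \<open>f\<close> is finite almost everywhere and may be replaced by the
    real-valued \<open>g\<close> in Bochner integrals.\<close>
  define g where "g x = enn2real (f x)" for x
  have g[measurable]: "g \<in> borel_measurable P" unfolding g_def by measurable
  have g0: "0 \<le> g x" for x by (simp add: g_def)
  have "(\<integral>\<^sup>+x. f x \<partial>P) \<le> emeasure Q (space P)"
    using le[OF sets.top] by (simp cong: nn_integral_cong)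
  then have ff: "(\<integral>\<^sup>+x. f x \<partial>P) \<noteq> \<infinity>"
    by (metis Q.emeasure_finite infinity_ennreal_def top.extremum_unique)
  then have fin: "AE x in P. f x \<noteq> \<infinity>" by (intro nn_integral_PInf_AE) auto
  then have fg: "AE x in P. ennreal (g x) = f x"
    by eventually_elim (simp add: g_def less_top)
  have int_f: "(\<integral>\<^sup>+x. ennreal (g x) \<partial>P) = (\<integral>\<^sup>+x. f x \<partial>P)"
    using fg by (rule nn_integral_cong_AE)
  have int_g: "integrable P g"
    using ff int_f g0 by (intro integrableI_bounded) (auto simp: less_top)
  have int_f2: "(\<integral>\<^sup>+x. ennreal ((g x)\<^sup>2) \<partial>P) = (\<integral>\<^sup>+x. (f x)\<^sup>2 \<partial>P)"
    by (rule nn_integral_cong_AE, use fg in eventually_elim)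
      (simp add: g0 flip: ennreal_power)
  have int_g2: "integrable P (\<lambda>x. (g x)\<^sup>2)"
  proof (intro integrableI_bounded)
    show "(\<integral>\<^sup>+x. ennreal (norm ((g x)\<^sup>2)) \<partial>P) < \<infinity>"
      using second int_f2 by (simp add: ennreal_less_top order_le_less_trans)
  qed auto
  have g1: "1 - \<delta> \<le> (\<integral>x. g x \<partial>P)"
    using mass \<delta> g0 unfolding int_f[symmetric] nn_integral_eq_integral[OF int_g AE_I2[OF g0]]
    by (simp add: ennreal_le_iff integral_nonneg_AE)
  have g2: "(\<integral>x. (g x)\<^sup>2 \<partial>P) \<le> 1 + \<eta>"
    using second \<eta> unfolding int_f2[symmetric]
    by (subst (asm) nn_integral_eq_integral[OF int_g2]) (auto simp: ennreal_le_iff simp del: ennreal_plus)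
  have int_h: "integrable P (\<lambda>x. 1 - g x)" "integrable P (\<lambda>x. \<bar>1 - g x\<bar>)"
    using int_g by auto
  have exp: "(1 - g x)\<^sup>2 = 1 - 2 * g x + (g x)\<^sup>2" for x
    by (simp add: power2_eq_square algebra_simps)
  have int_h2: "integrable P (\<lambda>x. (1 - g x)\<^sup>2)"
    unfolding exp using int_g int_g2 by auto
  have "(\<integral>x. (1 - g x)\<^sup>2 \<partial>P) = 1 - 2 * (\<integral>x. g x \<partial>P) + (\<integral>x. (g x)\<^sup>2 \<partial>P)"
    unfolding exp using int_g int_g2 by (simp add: P.prob_space)
  then have h2: "(\<integral>x. (1 - g x)\<^sup>2 \<partial>P) \<le> 2 * \<delta> + \<eta>" using g1 g2 by simp
  \<comment> \<open>Cauchy-Schwarz, in the form that the variance of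
    \<open>\<bar>1 - g\<bar>\<close> is nonnegative.\<close>
  have "0 \<le> P.variance (\<lambda>x. \<bar>1 - g x\<bar>)" by (rule P.variance_positive)
  also have "\<dots> = (\<integral>x. (1 - g x)\<^sup>2 \<partial>P) - (\<integral>x. \<bar>1 - g x\<bar> \<partial>P)\<^sup>2"
    using int_h int_h2 by (subst P.variance_eq) auto
  finally have h1: "(\<integral>x. \<bar>1 - g x\<bar> \<partial>P) \<le> sqrt (2 * \<delta> + \<eta>)"
    using h2 by (intro real_le_rsqrt) simp
  have one: "measure P A - measure Q A \<le> sqrt (2 * \<delta> + \<eta>)" if A[measurable]: "A \<in> sets P" for A
  proof -
    have int_A: "integrable P (\<lambda>x. g x * indicator A x)" "integrable P (\<lambda>x. (1 - g x) * indicator A x)"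
      using int_g int_h by (auto intro!: integrable_real_mult_indicator A)
    have "(\<integral>\<^sup>+x. ennreal (g x * indicator A x) \<partial>P) = (\<integral>\<^sup>+x\<in>A. f x \<partial>P)"
      by (rule nn_integral_cong_AE, use fg in eventually_elim) (auto split: split_indicator)
    also have "\<dots> \<le> emeasure Q A" using A by (rule le)
    finally have "(\<integral>x. g x * indicator A x \<partial>P) \<le> measure Q A"
      using g0 by (subst (asm) nn_integral_eq_integral[OF int_A(1)])
        (auto simp: Q.emeasure_eq_measure)
    moreover have "(\<integral>x. (1 - g x) * indicator A x \<partial>P) =
        measure P A - (\<integral>x. g x * indicator A x \<partial>P)"
      using int_A A by (simp add: left_diff_distrib P.emeasure_eq_measure)
    moreover have "(\<integral>x. (1 - g x) * indicator A x \<partial>P) \<le> (\<integral>x. \<bar>1 - g x\<bar> \<partial>P)"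
      using int_A int_h by (intro integral_mono) (auto split: split_indicator)
    ultimately show ?thesis using h1 by linarith
  qed
  \<comment> \<open>Since \<open>f\<close> bounds \<open>Q\<close> only from below,
    \<open>one\<close> is one-sided; the complement of \<open>A\<close> supplies the other
    sign.\<close>
  have two: "\<bar>measure P A - measure Q A\<bar> \<le> sqrt (2 * \<delta> + \<eta>)" if A: "A \<in> sets P" for A
  proof -
    have "measure P (space P - A) = 1 - measure P A" "measure Q (space P - A) = 1 - measure Q A"
      using A sets space P.prob_compl Q.prob_compl by metis+
    then show ?thesis using one[OF A] one[of "space P - A"] A by auto
  qed
  then show ?thesis
    unfolding tv_dist_def by (intro cSUP_least) auto
qed

section \<open>Gaussian integrals\<close>

lemma nn_integral_cmult_normal:
  assumes "0 < \<sigma>" "0 \<le> c"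
  shows "(\<integral>\<^sup>+x. ennreal (c * normal_density \<mu> \<sigma> x) \<partial>lborel) = ennreal c"
  using assms by (subst nn_integral_eq_integral) auto

text \<open>Completing the square: the tilt by \<open>exp (a * x)\<close> moves the mean to
  \<open>a * \<sigma>\<^sup>2\<close> and leaves a constant factor.\<close>

lemma nn_integral_normal_exp_linear:
  assumes "0 < \<sigma>"
  shows "(\<integral>\<^sup>+x. ennreal (exp (a * x)) \<partial>density lborel (normal_density 0 \<sigma>)) =
    ennreal (exp (a\<^sup>2 * \<sigma>\<^sup>2 / 2))"
proof -
  have "normal_density 0 \<sigma> x * exp (a * x) =
      exp (a\<^sup>2 * \<sigma>\<^sup>2 / 2) * normal_density (a * \<sigma>\<^sup>2) \<sigma> x" for x
    using assms unfolding normal_density_def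
    by (auto simp: field_simps power2_eq_square simp flip: exp_add)
  then show ?thesis
    using assms
    by (simp add: nn_integral_density nn_integral_cmult_normal flip: ennreal_mult)
qed

text \<open>The factor \<open>exp (k * x\<^sup>2)\<close> turns the centred normal density into a
  multiple of the one with variance \<open>\<sigma>\<^sup>2 / q\<close>, where
  \<open>q = 1 - 2 * k * \<sigma>\<^sup>2\<close>; the multiple is the ratio of the normalising
  constants.\<close>

lemma nn_integral_normal_exp_square:
  assumes "0 < \<sigma>" "2 * k * \<sigma>\<^sup>2 < 1"
  shows "(\<integral>\<^sup>+x. ennreal (exp (k * x\<^sup>2)) \<partial>density lborel (normal_density 0 \<sigma>)) =
    ennreal (1 / sqrt (1 - 2 * k * \<sigma>\<^sup>2))"
proof -
  define q where "q = 1 - 2 * k * \<sigma>\<^sup>2"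
  have q: "0 < q" and k: "k = (1 - q) / (2 * \<sigma>\<^sup>2)"
    using assms by (auto simp: q_def)
  have "normal_density 0 \<sigma> x * exp (k * x\<^sup>2) =
      1 / sqrt q * normal_density 0 (\<sigma> / sqrt q) x" for x
  proof -
    have "- x\<^sup>2 / (2 * \<sigma>\<^sup>2) + k * x\<^sup>2 = - x\<^sup>2 / (2 * (\<sigma> / sqrt q)\<^sup>2)"
      using q assms by (simp add: k power_divide field_simps)
    then have "exp (- x\<^sup>2 / (2 * \<sigma>\<^sup>2)) * exp (k * x\<^sup>2) = exp (- x\<^sup>2 / (2 * (\<sigma> / sqrt q)\<^sup>2))"
      by (simp flip: exp_add)
    moreover have "1 / sqrt q * (1 / sqrt (2 * pi * (\<sigma> / sqrt q)\<^sup>2)) = 1 / sqrt (2 * pi * \<sigma>\<^sup>2)"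
      using q assms by (simp add: power_divide real_sqrt_mult real_sqrt_divide)
    ultimately show ?thesis
      unfolding normal_density_def by (simp add: mult.assoc[symmetric]
          del: times_divide_eq_left times_divide_eq_right)
  qed
  then show ?thesis
    using assms q
    by (simp add: nn_integral_density nn_integral_cmult_normal q_def[symmetric]
        del: times_divide_eq_left flip: ennreal_mult)
qed

text \<open>After squaring, the claim is \<open>1 \<le> (1 + x)\<^sup>2 * (1 - x)\<close>, whose
  right side is \<open>1 + x * (1 - x - x\<^sup>2)\<close>.\<close>

lemma inverse_sqrt_le_linear:
  assumes "0 \<le> x" "x \<le> 1 / 2"
  shows "1 / sqrt (1 - x) \<le> 1 + (x::real)"
proof -
  have "x * (x + x\<^sup>2) \<le> x * 1"
  proof (intro mult_left_mono)
    have "x\<^sup>2 \<le> (1 / 2)\<^sup>2" using assms by (intro power_mono)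
    then show "x + x\<^sup>2 \<le> 1" using assms by (simp add: power2_eq_square)
  qed (use assms in auto)
  then have "1 \<le> (1 + x)\<^sup>2 * (1 - x)" by (simp add: power2_eq_square algebra_simps)
  then have "1 \<le> sqrt ((1 + x)\<^sup>2 * (1 - x))" by simp
  also have "\<dots> = (1 + x) * sqrt (1 - x)" using assms by (simp add: real_sqrt_mult)
  finally show ?thesis using assms by (simp add: field_simps)
qed

text \<open>The inner integral is the exponential of a multiple of \<open>x\<^sup>2\<close>, so the
  outer one equals \<open>1 / sqrt (1 - u)\<close> with
  \<open>u = (m * \<sigma>\<^sup>2)\<^sup>2\<close>, which is at most \<open>1 + u\<close> and so at
  most \<open>exp u\<close>.\<close>

lemma nn_integral_normal_exp_bilinear:
  assumes "0 < \<sigma>" "(m * \<sigma>\<^sup>2)\<^sup>2 \<le> 1 / 2"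
  shows "(\<integral>\<^sup>+x. (\<integral>\<^sup>+y. ennreal (exp (m * x * y)) \<partial>density lborel (normal_density 0 \<sigma>))
      \<partial>density lborel (normal_density 0 \<sigma>)) \<le> ennreal (exp ((m * \<sigma>\<^sup>2)\<^sup>2))"
proof -
  have e: "(m * x)\<^sup>2 * \<sigma>\<^sup>2 / 2 = (m\<^sup>2 * \<sigma>\<^sup>2 / 2) * x\<^sup>2" for x
    by (simp add: power_mult_distrib)
  have k: "2 * (m\<^sup>2 * \<sigma>\<^sup>2 / 2) * \<sigma>\<^sup>2 = (m * \<sigma>\<^sup>2)\<^sup>2"
    by (simp add: power_mult_distrib power2_eq_square)
  have "(\<integral>\<^sup>+x. (\<integral>\<^sup>+y. ennreal (exp (m * x * y)) \<partial>density lborel (normal_density 0 \<sigma>))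
      \<partial>density lborel (normal_density 0 \<sigma>)) = ennreal (1 / sqrt (1 - (m * \<sigma>\<^sup>2)\<^sup>2))"
    using assms k by (simp only: nn_integral_normal_exp_linear e)
      (subst nn_integral_normal_exp_square, auto)
  also have "\<dots> \<le> ennreal (exp ((m * \<sigma>\<^sup>2)\<^sup>2))"
    using assms by (intro ennreal_leI order_trans[OF inverse_sqrt_le_linear exp_ge_add_one_self]) auto
  finally show ?thesis .
qed

lemma nn_integral_gaussian_iso_prod:
  assumes "0 < s" "\<And>j. j < d \<Longrightarrow> f j \<in> borel_measurable borel"
  shows "(\<integral>\<^sup>+x. (\<Prod>j<d. f j (x j)) \<partial>gaussian_iso d \<mu> s) =
    (\<Prod>j<d. \<integral>\<^sup>+x. f j x \<partial>density lborel (normal_density (\<mu> j) (sqrt s)))"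
proof -
  interpret product_sigma_finite "\<lambda>j. density lborel (normal_density (\<mu> j) (sqrt s))"
    using assms
    by (auto simp: product_sigma_finite_def intro!: prob_space_imp_sigma_finite prob_space_normal_density)
  show ?thesis
    unfolding gaussian_iso_def using assms by (intro product_nn_integral_prod) auto
qed

text \<open>Both integrals factor over the coordinates. Each coordinate has variance
  \<open>1 / d\<close> and contributes at most \<open>exp ((m / d)\<^sup>2)\<close>; the product of
  \<open>d\<close> such factors is \<open>exp (m\<^sup>2 / d)\<close>.\<close>

lemma nn_integral_gaussian_exp_inner:
  assumes "1 \<le> d" "\<bar>m\<bar> \<le> real d / 2"
  shows "(\<integral>\<^sup>+v. (\<integral>\<^sup>+w. ennreal (exp (m * (\<Sum>j<d. v j * w j))) \<partial>gaussian_iso d (\<lambda>_. 0) (1 / real d))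
      \<partial>gaussian_iso d (\<lambda>_. 0) (1 / real d)) \<le> ennreal (exp (m\<^sup>2 / real d))"
proof -
  let ?N = "density lborel (normal_density 0 (sqrt (1 / real d)))"
  have "exp (m * (\<Sum>j<d. v j * w j)) = (\<Prod>j<d. exp (m * v j * w j))" for v w :: "nat \<Rightarrow> real"
    by (simp add: exp_sum[symmetric] sum_distrib_left mult.assoc)
  then have "(\<integral>\<^sup>+v. (\<integral>\<^sup>+w. ennreal (exp (m * (\<Sum>j<d. v j * w j))) \<partial>gaussian_iso d (\<lambda>_. 0) (1 / real d))
      \<partial>gaussian_iso d (\<lambda>_. 0) (1 / real d)) =
    (\<integral>\<^sup>+v. (\<integral>\<^sup>+w. (\<Prod>j<d. ennreal (exp (m * v j * w j))) \<partial>gaussian_iso d (\<lambda>_. 0) (1 / real d))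
      \<partial>gaussian_iso d (\<lambda>_. 0) (1 / real d))"
    by (simp add: prod_ennreal)
  also have "\<dots> = (\<integral>\<^sup>+v. (\<Prod>j<d. \<integral>\<^sup>+y. ennreal (exp (m * v j * y)) \<partial>?N)
      \<partial>gaussian_iso d (\<lambda>_. 0) (1 / real d))"
    using assms by (subst nn_integral_gaussian_iso_prod) auto
  also have "\<dots> = (\<Prod>j<d. \<integral>\<^sup>+x. \<integral>\<^sup>+y. ennreal (exp (m * x * y)) \<partial>?N \<partial>?N)"
    using assms
    by (subst nn_integral_gaussian_iso_prod[where f="\<lambda>j x. \<integral>\<^sup>+y. ennreal (exp (m * x * y)) \<partial>?N"])
      (auto simp: nn_integral_normal_exp_linear)
  also have "\<dots> \<le> (\<Prod>j<d. ennreal (exp ((m * (sqrt (1 / real d))\<^sup>2)\<^sup>2)))"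
  proof (intro prod_mono_ennreal nn_integral_normal_exp_bilinear)
    have "\<bar>m * (sqrt (1 / real d))\<^sup>2\<bar> \<le> 1 / 2"
      using assms by (simp add: abs_mult field_simps)
    then have "(m * (sqrt (1 / real d))\<^sup>2)\<^sup>2 \<le> (1 / 2)\<^sup>2"
      by (simp add: abs_le_square_iff[symmetric])
    also have "(1 / 2)\<^sup>2 \<le> (1 / 2 :: real)" by (simp add: power2_eq_square)
    finally show "(m * (sqrt (1 / real d))\<^sup>2)\<^sup>2 \<le> 1 / 2" .
  qed (use assms in auto)
  also have "\<dots> = ennreal (exp (m\<^sup>2 / real d))"
    using assms by (simp add: prod_ennreal exp_of_nat_mult[symmetric] power_divide ennreal_power)
      (simp add: field_simps power2_eq_square)
  finally show ?thesis .
qed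

section \<open>Random labelings\<close>

text \<open>Gaussian linearisation \<open>exp (a\<^sup>2 m\<^sup>2 / 2) = E exp (a g m)\<close>, restricted to a window of \<open>g\<close>
  that carries almost all of the tilted mass. The window keeps the tilt \<open>a g\<close> in the range where
  the moment generating function of \<open>m\<close> is under control.\<close>

lemma exp_square_le_windowed_gaussian:
  assumes "0 < r" "0 \<le> a" "a * \<bar>m\<bar> + r \<le> R"
  shows "ennreal ((1 - 1 / r\<^sup>2) * exp (a\<^sup>2 * m\<^sup>2 / 2)) \<le>
    (\<integral>\<^sup>+g. ennreal (exp (a * g * m) * std_normal_density g) * indicator {-R..R} g \<partial>lborel)"
proof -
  let ?\<mu> = "a * m"
  have tilt: "exp (a * g * m) * std_normal_density g = exp (a\<^sup>2 * m\<^sup>2 / 2) * normal_density ?\<mu> 1 g" for g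
    unfolding normal_density_def
    by (auto simp: field_simps power2_eq_square simp flip: exp_add)
  \<comment> \<open>Chebyshev as a pointwise minorant: the factor
    \<open>1 - (g - a * m)\<^sup>2 / r\<^sup>2\<close> is at most 1 everywhere and nonpositive
    outside the window, because there \<open>g\<close> is at distance at least \<open>r\<close> from
    the tilted mean \<open>a * m\<close>.\<close>
  let ?h = "\<lambda>g. exp (a\<^sup>2 * m\<^sup>2 / 2) * (normal_density ?\<mu> 1 g - normal_density ?\<mu> 1 g * (g - ?\<mu>)^2 / r\<^sup>2)"
  have "has_bochner_integral lborel (\<lambda>x. normal_density ?\<mu> 1 x * (x - ?\<mu>) ^ 2) 1"
    using normal_moment_even[of 1 ?\<mu> 1] by (simp add: fact_numeral)
  then have I: "integrable lborel ?h" "(\<integral>g. ?h g \<partial>lborel) = (1 - 1 / r\<^sup>2) * exp (a\<^sup>2 * m\<^sup>2 / 2)"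
    by (auto simp: has_bochner_integral_iff)
  let ?k = "\<lambda>g. exp (a * g * m) * std_normal_density g * indicator {-R..R} g"
  have k: "integrable lborel ?k"
    unfolding tilt by (intro integrable_real_mult_indicator) auto
  have "(\<integral>g. ?h g \<partial>lborel) \<le> (\<integral>g. ?k g \<partial>lborel)"
  proof (intro integral_mono I(1) k)
    fix g
    have h: "?h g = exp (a\<^sup>2 * m\<^sup>2 / 2) * normal_density ?\<mu> 1 g * (1 - (g - ?\<mu>)\<^sup>2 / r\<^sup>2)"
      by (simp add: algebra_simps)
    show "?h g \<le> ?k g"
    proof (cases "\<bar>g\<bar> \<le> R")
      case True
      then show ?thesis
        unfolding tilt h by (auto intro!: mult_left_le simp: indicator_def)
    next
      case False
      then have "r \<le> \<bar>g - ?\<mu>\<bar>"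
        using assms abs_mult[of a m] by linarith
      then have "r\<^sup>2 \<le> (g - ?\<mu>)\<^sup>2"
        using assms by (simp add: abs_le_square_iff[symmetric])
      then have "?h g \<le> 0"
        unfolding h using assms by (intro mult_nonneg_nonpos) auto
      then show ?thesis using False by (auto split: split_indicator)
    qed
  qed
  then have "ennreal ((1 - 1 / r\<^sup>2) * exp (a\<^sup>2 * m\<^sup>2 / 2)) \<le> ennreal (\<integral>g. ?k g \<partial>lborel)"
    unfolding I(2) by (rule ennreal_leI)
  also have "\<dots> = (\<integral>\<^sup>+g. ennreal (?k g) \<partial>lborel)"
    using k by (intro nn_integral_eq_integral[symmetric]) auto
  also have "\<dots> = (\<integral>\<^sup>+g. ennreal (exp (a * g * m) * std_normal_density g) * indicator {-R..R} g \<partial>lborel)"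
    by (intro nn_integral_cong) (auto split: split_indicator)
  finally show ?thesis .
qed

lemma exp_le_quadratic:
  assumes "\<bar>x\<bar> \<le> 1"
  shows "exp x \<le> 1 + x + (x::real)\<^sup>2"
proof (cases "0 \<le> x")
  case True
  then show ?thesis using assms by (intro exp_bound) auto
next
  case False
  define y where "y = - x"
  have y: "0 \<le> y" "y \<le> 1" using False assms by (auto simp: y_def)
  \<comment> \<open>The product equals \<open>1 + y ^ 3\<close>.\<close>
  have "1 \<le> (1 - y + y\<^sup>2) * (1 + y)" using y by (simp add: algebra_simps power2_eq_square)
  also have "\<dots> \<le> (1 - y + y\<^sup>2) * exp y"
  proof (intro mult_left_mono exp_ge_add_one_self)
    show "0 \<le> 1 - y + y\<^sup>2" using y zero_le_power2[of y] by linarith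
  qed
  finally have "exp (- y) \<le> 1 - y + y\<^sup>2" by (simp add: exp_minus field_simps)
  then show ?thesis by (simp add: y_def)
qed

section \<open>Labels, typical labelings and their overlaps\<close>

definition prob_label :: "real \<Rightarrow> bool \<Rightarrow> real" where
  "prob_label \<epsilon> b = (if b then \<epsilon> else 1 - \<epsilon>)"

text \<open>The coefficient of \<open>v\<close> in the mean of the component chosen by the label,
  \<open>True\<close> being the minority component. For \<open>0 < \<epsilon>\<close> the two values
  average to zero under \<open>prob_label\<close>.\<close>

definition label_shift :: "real \<Rightarrow> real \<Rightarrow> bool \<Rightarrow> real" where
  "label_shift \<alpha> \<epsilon> b = (if b then - ((1 - \<epsilon>) / \<epsilon>) * \<alpha> else \<alpha>)"

text \<open>The product of the shifts of two independent labels is centred, and the range of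
  \<open>l\<close> keeps the exponent in \<open>[-1, 1]\<close>, where
  \<open>exp x \<le> 1 + x + x\<^sup>2\<close>. Only the second moment of the product survives, and
  it is at most \<open>\<alpha> ^ 4 / \<epsilon>\<^sup>2\<close>.\<close>

lemma label_mgf_le:
  assumes "0 < \<alpha>" "0 < \<epsilon>" "\<epsilon> < 1" and l: "\<bar>l\<bar> \<le> \<epsilon>\<^sup>2 / \<alpha>\<^sup>2"
  shows "(\<Sum>a\<in>UNIV. \<Sum>b\<in>UNIV. prob_label \<epsilon> a * prob_label \<epsilon> b *
      exp (l * (label_shift \<alpha> \<epsilon> a * label_shift \<alpha> \<epsilon> b))) \<le> exp (l\<^sup>2 * \<alpha> ^ 4 / \<epsilon>\<^sup>2)"
proof -
  let ?p = "prob_label \<epsilon>" and ?s = "label_shift \<alpha> \<epsilon>"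
  have p: "0 \<le> ?p b" for b using assms by (simp add: prob_label_def)
  have s: "\<bar>?s b\<bar> \<le> \<alpha> / \<epsilon>" for b
    using assms by (auto simp: label_shift_def abs_mult field_simps mult_left_le)
  have x: "\<bar>l * (?s a * ?s b)\<bar> \<le> 1" for a b
  proof -
    have "\<bar>?s a * ?s b\<bar> \<le> \<alpha> / \<epsilon> * (\<alpha> / \<epsilon>)"
      unfolding abs_mult using s assms by (intro mult_mono) auto
    then have "\<bar>l * (?s a * ?s b)\<bar> \<le> \<epsilon>\<^sup>2 / \<alpha>\<^sup>2 * (\<alpha> / \<epsilon> * (\<alpha> / \<epsilon>))"
      unfolding abs_mult[of l] using l by (intro mult_mono) auto
    also have "\<dots> = 1" using assms by (simp add: field_simps power2_eq_square)
    finally show ?thesis .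
  qed
  have "(\<Sum>a\<in>UNIV. \<Sum>b\<in>UNIV. ?p a * ?p b * exp (l * (?s a * ?s b))) \<le>
      (\<Sum>a\<in>UNIV. \<Sum>b\<in>UNIV. ?p a * ?p b * (1 + l * (?s a * ?s b) + (l * (?s a * ?s b))\<^sup>2))"
    using p x by (intro sum_mono mult_left_mono exp_le_quadratic) auto
  \<comment> \<open>Independence of the two labels turns each double sum into the square of a single
    one: total mass, mean and second moment.\<close>
  also have "\<dots> = (\<Sum>a\<in>UNIV. ?p a)\<^sup>2 + l * (\<Sum>a\<in>UNIV. ?p a * ?s a)\<^sup>2 + l\<^sup>2 * (\<Sum>a\<in>UNIV. ?p a * (?s a)\<^sup>2)\<^sup>2"
    by (simp add: UNIV_bool power2_eq_square algebra_simps)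
  also have "(\<Sum>a\<in>UNIV. ?p a) = 1" by (simp add: UNIV_bool prob_label_def)
  also have "(\<Sum>a\<in>UNIV. ?p a * ?s a) = 0"
    using assms by (simp add: UNIV_bool prob_label_def label_shift_def field_simps)
  also have "(\<Sum>a\<in>UNIV. ?p a * (?s a)\<^sup>2) = \<alpha>\<^sup>2 * (1 - \<epsilon>) / \<epsilon>"
    using assms by (simp add: UNIV_bool prob_label_def label_shift_def field_simps power2_eq_square)
  also have "1\<^sup>2 + l * 0\<^sup>2 + l\<^sup>2 * (\<alpha>\<^sup>2 * (1 - \<epsilon>) / \<epsilon>)\<^sup>2 \<le> 1 + l\<^sup>2 * (\<alpha>\<^sup>2 / \<epsilon>)\<^sup>2"
    using assms by (auto intro!: mult_left_mono power_mono divide_right_mono mult_left_le)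
  also have "\<dots> = 1 + l\<^sup>2 * \<alpha> ^ 4 / \<epsilon>\<^sup>2"
    by (simp add: power_divide flip: power_mult)
  also have "\<dots> \<le> exp (l\<^sup>2 * \<alpha> ^ 4 / \<epsilon>\<^sup>2)" by (rule exp_ge_add_one_self)
  finally show ?thesis .
qed

abbreviation labelings :: "nat \<Rightarrow> (nat \<Rightarrow> bool) set" where
  "labelings n \<equiv> {..<n} \<rightarrow>\<^sub>E UNIV"

definition weight :: "nat \<Rightarrow> real \<Rightarrow> (nat \<Rightarrow> bool) \<Rightarrow> real" where
  "weight n \<epsilon> b = (\<Prod>i<n. prob_label \<epsilon> (b i))"

definition overlap :: "nat \<Rightarrow> real \<Rightarrow> real \<Rightarrow> (nat \<Rightarrow> bool) \<Rightarrow> (nat \<Rightarrow> bool) \<Rightarrow> real" where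
  "overlap n \<alpha> \<epsilon> a b = (\<Sum>i<n. label_shift \<alpha> \<epsilon> (a i) * label_shift \<alpha> \<epsilon> (b i))"

definition typical :: "nat \<Rightarrow> real \<Rightarrow> (nat \<Rightarrow> bool) set" where
  "typical n \<epsilon> = {b \<in> labelings n. (\<Sum>i<n. of_bool (b i)) \<le> 3 * \<epsilon> * real n}"

lemma finite_labelings: "finite (labelings n)"
  by (intro finite_PiE) auto

lemma typical_subset: "typical n \<epsilon> \<subseteq> labelings n"
  by (auto simp: typical_def)

lemma weight_nonneg: "0 \<le> \<epsilon> \<Longrightarrow> \<epsilon> \<le> 1 \<Longrightarrow> 0 \<le> weight n \<epsilon> b"
  by (auto simp: weight_def prob_label_def intro!: prod_nonneg)

lemma sum_labelings_prod:
  fixes f :: "bool \<Rightarrow> 'a :: comm_semiring_1"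
  shows "(\<Sum>b\<in>labelings n. \<Prod>i<n. f (b i)) = (\<Sum>x\<in>UNIV. f x) ^ n"
  using prod_sum_PiE[of "{..<n}" "\<lambda>_. UNIV" "\<lambda>_. f"] by simp

text \<open>Chernoff bound: on atypical labelings the indicator is dominated by
  \<open>exp (k - 3 * \<epsilon> * n)\<close> with \<open>k\<close> the number of minority labels,
  and the exponential moment of \<open>k\<close> factors over the samples.\<close>

lemma sum_weight_typical:
  assumes "0 \<le> \<epsilon>" "\<epsilon> \<le> 1"
  shows "1 - exp (- \<epsilon> * real n) \<le> (\<Sum>b\<in>typical n \<epsilon>. weight n \<epsilon> b)"
proof -
  let ?k = "\<lambda>b. \<Sum>i<n. of_bool (b i) :: real"
  have "(\<Sum>b\<in>labelings n. weight n \<epsilon> b) = 1"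
    unfolding weight_def sum_labelings_prod by (simp add: UNIV_bool prob_label_def)
  then have 1: "(\<Sum>b\<in>typical n \<epsilon>. weight n \<epsilon> b) =
      1 - (\<Sum>b\<in>labelings n - typical n \<epsilon>. weight n \<epsilon> b)"
    using sum.subset_diff[OF typical_subset finite_labelings, of "weight n \<epsilon>" n \<epsilon>] by simp
  have "(\<Sum>b\<in>labelings n - typical n \<epsilon>. weight n \<epsilon> b) \<le>
      (\<Sum>b\<in>labelings n - typical n \<epsilon>. weight n \<epsilon> b * exp (?k b - 3 * \<epsilon> * real n))"
  proof (rule sum_mono)
    fix b assume "b \<in> labelings n - typical n \<epsilon>"
    then have "\<not> ?k b \<le> 3 * \<epsilon> * real n" unfolding typical_def by blast
    then have "1 \<le> exp (?k b - 3 * \<epsilon> * real n)" unfolding one_le_exp_iff by linarith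
    from mult_left_mono[OF this weight_nonneg[OF assms]]
    show "weight n \<epsilon> b \<le> weight n \<epsilon> b * exp (?k b - 3 * \<epsilon> * real n)"
      unfolding mult_1_right .
  qed
  also have "\<dots> \<le> (\<Sum>b\<in>labelings n. weight n \<epsilon> b * exp (?k b - 3 * \<epsilon> * real n))"
    using weight_nonneg[OF assms] by (intro sum_mono2 finite_labelings) auto
  also have "\<dots> = exp (- 3 * \<epsilon> * real n) *
      (\<Sum>b\<in>labelings n. \<Prod>i<n. prob_label \<epsilon> (b i) * exp (of_bool (b i)))"
    unfolding weight_def exp_diff exp_sum[OF finite_lessThan] prod.distrib sum_distrib_left
    by (simp add: exp_minus field_simps)
  also have "\<dots> = exp (- 3 * \<epsilon> * real n) * (1 + \<epsilon> * (exp 1 - 1)) ^ n"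
    using sum_labelings_prod[of "\<lambda>x. prob_label \<epsilon> x * exp (of_bool x)" n]
    by (simp add: UNIV_bool prob_label_def algebra_simps)
  also have "\<dots> \<le> exp (- 3 * \<epsilon> * real n) * exp (2 * \<epsilon>) ^ n"
  proof (intro mult_left_mono power_mono)
    \<comment> \<open>From \<open>exp 1 \<le> 3\<close>. The moment costs at most
      \<open>exp (2 * \<epsilon> * n)\<close>, so the threshold with factor 3 leaves
      \<open>exp (- \<epsilon> * n)\<close>.\<close>
    have "\<epsilon> * (exp 1 - 1) \<le> \<epsilon> * 2" using assms exp_le by (intro mult_left_mono) auto
    then show "1 + \<epsilon> * (exp 1 - 1) \<le> exp (2 * \<epsilon>)"
      using exp_ge_add_one_self[of "2 * \<epsilon>"] by linarith
    show "0 \<le> 1 + \<epsilon> * (exp 1 - 1)"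
      using assms exp_ge_add_one_self[of 1] by (intro add_nonneg_nonneg mult_nonneg_nonneg) auto
  qed auto
  also have "\<dots> = exp (- \<epsilon> * real n)"
    by (simp add: algebra_simps flip: exp_of_nat_mult exp_add)
  finally show ?thesis unfolding 1 by simp
qed

text \<open>Every label contributes at most \<open>\<alpha>\<^sup>2\<close>, and a minority label at
  most \<open>\<alpha>\<^sup>2 / \<epsilon>\<^sup>2\<close> on top. With at most
  \<open>3 * \<epsilon> * n\<close> minority labels the total is at most
  \<open>\<alpha>\<^sup>2 * n + 3 * \<alpha>\<^sup>2 * n / \<epsilon>\<close>.\<close>

lemma sum_label_shift_square_le:
  assumes "0 < \<epsilon>" "\<epsilon> < 1" "b \<in> typical n \<epsilon>"
  shows "(\<Sum>i<n. (label_shift \<alpha> \<epsilon> (b i))\<^sup>2) \<le> 4 * \<alpha>\<^sup>2 * real n / \<epsilon>"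
proof -
  have "(label_shift \<alpha> \<epsilon> x)\<^sup>2 \<le> \<alpha>\<^sup>2 + \<alpha>\<^sup>2 / \<epsilon>\<^sup>2 * of_bool x" for x
  proof (cases x)
    case True
    have "((1 - \<epsilon>) * \<alpha>)\<^sup>2 \<le> \<alpha>\<^sup>2"
      using assms by (auto simp: power_mult_distrib intro!: mult_left_le_one_le power_le_one)
    then have "((1 - \<epsilon>) * \<alpha> / \<epsilon>)\<^sup>2 \<le> \<alpha>\<^sup>2 / \<epsilon>\<^sup>2"
      unfolding power_divide by (intro divide_right_mono) auto
    moreover have "(label_shift \<alpha> \<epsilon> x)\<^sup>2 = ((1 - \<epsilon>) * \<alpha> / \<epsilon>)\<^sup>2"
      using True by (simp add: label_shift_def)
    ultimately show ?thesis using True by (simp add: add_increasing)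
  qed (simp add: label_shift_def)
  then have "(\<Sum>i<n. (label_shift \<alpha> \<epsilon> (b i))\<^sup>2) \<le> (\<Sum>i<n. \<alpha>\<^sup>2 + \<alpha>\<^sup>2 / \<epsilon>\<^sup>2 * of_bool (b i))"
    by (rule sum_mono)
  also have "\<dots> = \<alpha>\<^sup>2 * real n + \<alpha>\<^sup>2 / \<epsilon>\<^sup>2 * (\<Sum>i<n. of_bool (b i))"
    unfolding sum.distrib sum_distrib_left by simp
  also have "\<dots> \<le> \<alpha>\<^sup>2 * real n / \<epsilon> + \<alpha>\<^sup>2 / \<epsilon>\<^sup>2 * (3 * \<epsilon> * real n)"
  proof (intro add_mono mult_left_mono)
    show "\<alpha>\<^sup>2 * real n \<le> \<alpha>\<^sup>2 * real n / \<epsilon>"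
      using assms by (simp add: field_simps mult_left_le_one_le)
  qed (use assms in \<open>auto simp: typical_def\<close>)
  also have "\<dots> = 4 * \<alpha>\<^sup>2 * real n / \<epsilon>"
    using assms by (simp add: field_simps power2_eq_square)
  finally show ?thesis .
qed

text \<open>The inequality of arithmetic and geometric means, applied termwise, reduces the overlap
  to the mean of the two sums of squares.\<close>

lemma abs_overlap_le:
  assumes "0 < \<epsilon>" "\<epsilon> < 1" "a \<in> typical n \<epsilon>" "b \<in> typical n \<epsilon>"
  shows "\<bar>overlap n \<alpha> \<epsilon> a b\<bar> \<le> 4 * \<alpha>\<^sup>2 * real n / \<epsilon>"
proof -
  have amgm: "\<bar>x * y\<bar> \<le> (x\<^sup>2 + y\<^sup>2) / 2" for x y :: real
    using sum_squares_bound[of "\<bar>x\<bar>" "\<bar>y\<bar>"] by (simp add: abs_mult)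
  have mean: "(x + y) / 2 \<le> z" if "x \<le> z" "y \<le> z" for x y z :: real
    using that by simp
  have "\<bar>overlap n \<alpha> \<epsilon> a b\<bar> \<le>
      (\<Sum>i<n. ((label_shift \<alpha> \<epsilon> (a i))\<^sup>2 + (label_shift \<alpha> \<epsilon> (b i))\<^sup>2) / 2)"
    unfolding overlap_def by (rule order_trans[OF sum_abs sum_mono]) (rule amgm)
  also have "\<dots> = ((\<Sum>i<n. (label_shift \<alpha> \<epsilon> (a i))\<^sup>2) + (\<Sum>i<n. (label_shift \<alpha> \<epsilon> (b i))\<^sup>2)) / 2"
    by (simp add: sum.distrib sum_divide_distrib[symmetric])
  also have "\<dots> \<le> 4 * \<alpha>\<^sup>2 * real n / \<epsilon>"
    using assms by (intro mean sum_label_shift_square_le)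
  finally show ?thesis .
qed

text \<open>Under the product weights the pairs \<open>(a i, b i)\<close> are independent, so the
  moment generating function is the \<open>n\<close>-th power of that of a single pair.\<close>

lemma overlap_mgf_le:
  assumes "0 < \<alpha>" "0 < \<epsilon>" "\<epsilon> < 1" and l: "\<bar>l\<bar> \<le> \<epsilon>\<^sup>2 / \<alpha>\<^sup>2"
  shows "(\<Sum>a\<in>labelings n. \<Sum>b\<in>labelings n. weight n \<epsilon> a * weight n \<epsilon> b *
      exp (l * overlap n \<alpha> \<epsilon> a b)) \<le> exp (real n * (l\<^sup>2 * \<alpha> ^ 4 / \<epsilon>\<^sup>2))"
proof -
  let ?p = "prob_label \<epsilon>" and ?s = "label_shift \<alpha> \<epsilon>"
  let ?F = "\<lambda>x y. ?p x * ?p y * exp (l * (?s x * ?s y))"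
  have "(\<Sum>a\<in>labelings n. \<Sum>b\<in>labelings n. weight n \<epsilon> a * weight n \<epsilon> b *
      exp (l * overlap n \<alpha> \<epsilon> a b)) = (\<Sum>a\<in>labelings n. \<Sum>b\<in>labelings n. \<Prod>i<n. ?F (a i) (b i))"
    by (simp add: weight_def overlap_def prod.distrib sum_distrib_left exp_sum)
  also have "\<dots> = (\<Sum>a\<in>labelings n. \<Prod>i<n. \<Sum>y\<in>UNIV. ?F (a i) y)"
    by (intro sum.cong refl prod_sum_PiE[symmetric]) auto
  also have "\<dots> = (\<Sum>x\<in>UNIV. \<Sum>y\<in>UNIV. ?F x y) ^ n"
    by (rule sum_labelings_prod)
  also have "\<dots> \<le> exp (l\<^sup>2 * \<alpha> ^ 4 / \<epsilon>\<^sup>2) ^ n"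
    using assms by (intro power_mono label_mgf_le sum_nonneg) (auto simp: prob_label_def)
  finally show ?thesis by (simp only: exp_of_nat_mult)
qed

text \<open>Each \<open>exp (m\<^sup>2 / d)\<close> is linearised by a windowed Gaussian
  \<open>g\<close>, and the finite sums are moved inside the integral. Inside the window the moment
  generating function bound for the overlap applies with \<open>l = t * g\<close>; a Gaussian
  integral of \<open>exp (k * g\<^sup>2)\<close> remains.\<close>

lemma sum_typical_exp_overlap_square_le:
  assumes \<alpha>: "0 < \<alpha>" and \<epsilon>: "0 < \<epsilon>" "\<epsilon> < 1" and d: "1 \<le> d" and r: "1 < r"
    and window: "sqrt (2 / real d) * (sqrt (2 / real d) * (4 * \<alpha>\<^sup>2 * real n / \<epsilon>) + r) \<le> \<epsilon>\<^sup>2 / \<alpha>\<^sup>2"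
    and small: "4 * (real n * \<alpha> ^ 4 / (real d * \<epsilon>\<^sup>2)) < 1"
  shows "(1 - 1 / r\<^sup>2) * (\<Sum>a\<in>typical n \<epsilon>. \<Sum>b\<in>typical n \<epsilon>. weight n \<epsilon> a * weight n \<epsilon> b *
      exp ((overlap n \<alpha> \<epsilon> a b)\<^sup>2 / real d)) \<le>
    1 / sqrt (1 - 4 * (real n * \<alpha> ^ 4 / (real d * \<epsilon>\<^sup>2)))"
proof -
  let ?T = "typical n \<epsilon>" and ?w = "weight n \<epsilon>" and ?m = "overlap n \<alpha> \<epsilon>"
  \<comment> \<open>The tilt \<open>t\<close> satisfies
    \<open>t\<^sup>2 * m\<^sup>2 / 2 = m\<^sup>2 / d\<close>. The radius \<open>R\<close> is the
    largest tilted mean \<open>t * \<bar>m\<bar>\<close> over typical pairs plus the slack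
    \<open>r\<close>, so \<open>window\<close> says
    \<open>t * R \<le> \<epsilon>\<^sup>2 / \<alpha>\<^sup>2\<close>.\<close>
  define t where "t = sqrt (2 / real d)"
  define R where "R = t * (4 * \<alpha>\<^sup>2 * real n / \<epsilon>) + r"
  define k where "k = 2 * (real n * \<alpha> ^ 4 / (real d * \<epsilon>\<^sup>2))"
  have t: "0 \<le> t" "t\<^sup>2 = 2 / real d" by (auto simp: t_def)
  have w: "0 \<le> ?w a" for a using \<epsilon> by (intro weight_nonneg) auto
  have r2: "1 / r\<^sup>2 < 1" using r by (simp add: one_less_power)
  let ?G = "\<lambda>a b g. ennreal (exp (t * g * ?m a b) * std_normal_density g) * indicator {-R..R} g"
  have "ennreal ((1 - 1 / r\<^sup>2) * (\<Sum>a\<in>?T. \<Sum>b\<in>?T. ?w a * ?w b * exp ((?m a b)\<^sup>2 / real d))) =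
      (\<Sum>a\<in>?T. \<Sum>b\<in>?T. ennreal (?w a * ?w b) *
        ennreal ((1 - 1 / r\<^sup>2) * exp (t\<^sup>2 * (?m a b)\<^sup>2 / 2)))"
    using w r2 by (simp add: t(2) sum_distrib_left sum_nonneg ac_simps flip: ennreal_mult)
  also have "\<dots> \<le> (\<Sum>a\<in>?T. \<Sum>b\<in>?T. ennreal (?w a * ?w b) * (\<integral>\<^sup>+g. ?G a b g \<partial>lborel))"
  proof (intro sum_mono mult_left_mono exp_square_le_windowed_gaussian)
    fix a b assume "a \<in> ?T" "b \<in> ?T"
    then show "t * \<bar>?m a b\<bar> + r \<le> R"
      unfolding R_def using t \<epsilon> by (intro add_mono mult_left_mono abs_overlap_le) auto
  qed (use t r in auto)
  also have "\<dots> = (\<integral>\<^sup>+g. (\<Sum>a\<in>?T. \<Sum>b\<in>?T. ennreal (?w a * ?w b) * ?G a b g) \<partial>lborel)"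
    by (simp add: nn_integral_sum nn_integral_cmult)
  also have "\<dots> \<le> (\<integral>\<^sup>+g. ennreal (std_normal_density g) * ennreal (exp (k * g\<^sup>2)) \<partial>lborel)"
  proof (intro nn_integral_mono)
    fix g :: real
    show "(\<Sum>a\<in>?T. \<Sum>b\<in>?T. ennreal (?w a * ?w b) * ?G a b g) \<le>
        ennreal (std_normal_density g) * ennreal (exp (k * g\<^sup>2))"
    proof (cases "\<bar>g\<bar> \<le> R")
      case True
      have "\<bar>t * g\<bar> \<le> t * R" using True t by (simp add: abs_mult mult_left_mono)
      then have l: "\<bar>t * g\<bar> \<le> \<epsilon>\<^sup>2 / \<alpha>\<^sup>2"
        using window by (simp add: R_def t_def)
      \<comment> \<open>Typicality has served to fix the window. For fixed \<open>g\<close> the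
        nonnegative sum may be extended to all labelings, which restores the product
        structure.\<close>
      have "(\<Sum>a\<in>?T. \<Sum>b\<in>?T. ?w a * ?w b * exp (t * g * ?m a b)) \<le>
          (\<Sum>a\<in>labelings n. \<Sum>b\<in>labelings n. ?w a * ?w b * exp (t * g * ?m a b))"
        using w by (intro order_trans[OF sum_mono[OF sum_mono2] sum_mono2] finite_labelings
            typical_subset sum_nonneg) auto
      also have "\<dots> \<le> exp (real n * ((t * g)\<^sup>2 * \<alpha> ^ 4 / \<epsilon>\<^sup>2))"
        using \<alpha> \<epsilon> l by (rule overlap_mgf_le)
      also have "real n * ((t * g)\<^sup>2 * \<alpha> ^ 4 / \<epsilon>\<^sup>2) = k * g\<^sup>2"
        by (simp add: k_def power_mult_distrib t(2))
      finally have "std_normal_density g * (\<Sum>a\<in>?T. \<Sum>b\<in>?T. ?w a * ?w b * exp (t * g * ?m a b)) \<le>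
          std_normal_density g * exp (k * g\<^sup>2)"
        by (rule mult_left_mono) simp
      moreover have "(\<Sum>a\<in>?T. \<Sum>b\<in>?T. ennreal (?w a * ?w b) * ?G a b g) =
          ennreal (std_normal_density g * (\<Sum>a\<in>?T. \<Sum>b\<in>?T. ?w a * ?w b * exp (t * g * ?m a b)))"
        using w True by (simp add: sum_distrib_left ac_simps sum_nonneg abs_le_iff minus_le_iff
            flip: ennreal_mult)
      ultimately show ?thesis by (simp add: ennreal_leI flip: ennreal_mult)
    qed (auto simp: indicator_def)
  qed
  also have "\<dots> = ennreal (1 / sqrt (1 - 4 * (real n * \<alpha> ^ 4 / (real d * \<epsilon>\<^sup>2))))"
    using nn_integral_normal_exp_square[of 1 k] small
    by (simp add: nn_integral_density k_def)
  finally show ?thesis using small by (subst (asm) ennreal_le_iff) auto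
qed

section \<open>Likelihood ratios\<close>

text \<open>A product measure is determined by its values on boxes, where the indicator splits over
  the coordinates and the integral factors.\<close>

lemma PiM_density:
  assumes I: "finite I" and f: "\<And>i. f i \<in> borel_measurable (M i)"
    and M: "\<And>i. sigma_finite_measure (M i)" "\<And>i. sigma_finite_measure (density (M i) (f i))"
  shows "(\<Pi>\<^sub>M i\<in>I. density (M i) (f i)) = density (PiM I M) (\<lambda>x. \<Prod>i\<in>I. f i (x i))"
proof -
  interpret M: product_sigma_finite M using M(1) by (simp add: product_sigma_finite_def)
  interpret D: product_sigma_finite "\<lambda>i. density (M i) (f i)"
    using M(2) by (simp add: product_sigma_finite_def)
  have [measurable]: "(\<lambda>x. \<Prod>i\<in>I. f i (x i)) \<in> borel_measurable (PiM I M)"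
    using f by (auto intro!: borel_measurable_prod_ennreal measurable_compose[OF measurable_component_singleton])
  show ?thesis
  proof (rule D.PiM_eqI[OF I, symmetric])
    show "sets (density (PiM I M) (\<lambda>x. \<Prod>i\<in>I. f i (x i))) = sets (\<Pi>\<^sub>M i\<in>I. density (M i) (f i))"
      by (simp cong: sets_PiM_cong)
    fix A assume "\<And>i. i \<in> I \<Longrightarrow> A i \<in> sets (density (M i) (f i))"
    then have A: "\<And>i. i \<in> I \<Longrightarrow> A i \<in> sets (M i)" by simp
    then have [measurable]: "Pi\<^sub>E I A \<in> sets (PiM I M)" using I by (intro sets_PiM_I_finite) auto
    have "emeasure (density (PiM I M) (\<lambda>x. \<Prod>i\<in>I. f i (x i))) (Pi\<^sub>E I A) =
        (\<integral>\<^sup>+x. (\<Prod>i\<in>I. f i (x i) * indicator (A i) (x i)) \<partial>PiM I M)"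
      by (auto simp: emeasure_density prod.distrib indicator_def space_PiM PiE_iff prod_eq_1_iff I
          intro!: nn_integral_cong)
    also have "\<dots> = (\<Prod>i\<in>I. \<integral>\<^sup>+x. f i x * indicator (A i) x \<partial>M i)"
      using f A I by (intro M.product_nn_integral_prod) auto
    also have "\<dots> = (\<Prod>i\<in>I. emeasure (density (M i) (f i)) (A i))"
      using f A by (intro prod.cong) (auto simp: emeasure_density)
    finally show "emeasure (density (PiM I M) (\<lambda>x. \<Prod>i\<in>I. f i (x i))) (Pi\<^sub>E I A) =
        (\<Prod>i\<in>I. emeasure (density (M i) (f i)) (A i))" .
  qed
qed

text \<open>The density of \<open>N(\<mu>, I)\<close> with respect to \<open>N(0, I)\<close>, as a
  product so that integrals factor over coordinates.\<close>

definition lr :: "nat \<Rightarrow> (nat \<Rightarrow> real) \<Rightarrow> (nat \<Rightarrow> real) \<Rightarrow> real" where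
  "lr d \<mu> x = (\<Prod>j<d. exp (\<mu> j * x j - (\<mu> j)\<^sup>2 / 2))"

lemma lr_nonneg: "0 \<le> lr d \<mu> x"
  by (simp add: lr_def prod_nonneg)

lemma prob_space_gaussian_iso: "0 < s \<Longrightarrow> prob_space (gaussian_iso d \<mu> s)"
  and sets_gaussian_iso: "0 < s \<Longrightarrow> sets (gaussian_iso d \<mu> s) = sets (vec_space d)"
  using gaussian_iso_in_prob_algebra[of s d \<mu>] by (auto simp: space_prob_algebra)

lemma measurable_gaussian_iso_component:
  assumes "0 < s" "j < d"
  shows "(\<lambda>x. x j) \<in> borel_measurable (gaussian_iso d \<mu> s)"
  unfolding measurable_cong_sets[OF sets_gaussian_iso[OF assms(1)] refl]
  using assms(2) by (intro measurable_component_singleton) auto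

lemma borel_measurable_lr: "lr d \<mu> \<in> borel_measurable (gaussian_iso d \<nu> 1)"
  unfolding lr_def[abs_def]
  by (intro borel_measurable_prod measurable_compose[OF _ borel_measurable_exp]
      borel_measurable_diff borel_measurable_times borel_measurable_const
      measurable_gaussian_iso_component) auto

lemma density_normal_lr:
  "density (density lborel std_normal_density) (\<lambda>x. ennreal (exp (m * x - m\<^sup>2 / 2))) =
    density lborel (normal_density m 1)"
proof -
  have "std_normal_density x * exp (m * x - m\<^sup>2 / 2) = normal_density m 1 x" for x
    unfolding normal_density_def by (auto simp: field_simps power2_eq_square simp flip: exp_add)
  then show ?thesis
    by (subst density_density_eq) (auto simp flip: ennreal_mult)
qed

lemma gaussian_iso_eq_density:
  "gaussian_iso d \<mu> 1 = density (gaussian_iso d (\<lambda>_. 0) 1) (\<lambda>x. ennreal (lr d \<mu> x))"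
proof -
  have "(\<Pi>\<^sub>M j\<in>{..<d}. density (density lborel std_normal_density)
        (\<lambda>x. ennreal (exp (\<mu> j * x - (\<mu> j)\<^sup>2 / 2)))) =
      density (\<Pi>\<^sub>M j\<in>{..<d}. density lborel std_normal_density)
        (\<lambda>x. \<Prod>j<d. ennreal (exp (\<mu> j * x j - (\<mu> j)\<^sup>2 / 2)))"
    by (intro PiM_density)
      (auto simp: density_normal_lr intro!: prob_space_imp_sigma_finite prob_space_normal_density)
  then show ?thesis
    by (simp add: gaussian_iso_def density_normal_lr lr_def prod_ennreal)
qed

text \<open>The likelihood ratio of one observation given \<open>v\<close>, with its label summed
  out.\<close>

definition sample_lr :: "nat \<Rightarrow> real \<Rightarrow> real \<Rightarrow> (nat \<Rightarrow> real) \<Rightarrow> (nat \<Rightarrow> real) \<Rightarrow> ennreal" where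
  "sample_lr d \<alpha> \<epsilon> v x =
    (\<Sum>b\<in>UNIV. ennreal (prob_label \<epsilon> b * lr d (\<lambda>j. label_shift \<alpha> \<epsilon> b * v j) x))"

lemma borel_measurable_sample_lr: "sample_lr d \<alpha> \<epsilon> v \<in> borel_measurable (gaussian_iso d \<mu> 1)"
  unfolding sample_lr_def[abs_def] using borel_measurable_lr by measurable

lemma sample_mixture_eq_density:
  assumes "0 \<le> \<epsilon>" "\<epsilon> \<le> 1"
  shows "sample_mixture d \<alpha> \<epsilon> v = density (gaussian_iso d (\<lambda>_. 0) 1) (sample_lr d \<alpha> \<epsilon> v)"
proof (rule measure_eqI)
  show "sets (sample_mixture d \<alpha> \<epsilon> v) = sets (density (gaussian_iso d (\<lambda>_. 0) 1) (sample_lr d \<alpha> \<epsilon> v))"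
    by (simp add: sample_mixture_def sets_gaussian_iso)
  fix A assume "A \<in> sets (sample_mixture d \<alpha> \<epsilon> v)"
  then have A: "A \<in> sets (gaussian_iso d \<mu> 1)" for \<mu>
    by (simp add: sample_mixture_def sets_gaussian_iso)
  note [measurable] = borel_measurable_lr borel_measurable_sample_lr
  let ?N = "gaussian_iso d (\<lambda>_. 0) 1"
  have e: "emeasure (gaussian_iso d \<mu> 1) A = (\<integral>\<^sup>+x. ennreal (lr d \<mu> x) * indicator A x \<partial>?N)" for \<mu>
    by (subst gaussian_iso_eq_density) (use A in \<open>simp add: emeasure_density\<close>)
  have "emeasure (sample_mixture d \<alpha> \<epsilon> v) A =
      ennreal (1 - \<epsilon>) * emeasure (gaussian_iso d (\<lambda>i. label_shift \<alpha> \<epsilon> False * v i) 1) A +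
      ennreal \<epsilon> * emeasure (gaussian_iso d (\<lambda>i. label_shift \<alpha> \<epsilon> True * v i) 1) A"
    unfolding sample_mixture_def using A
    by (subst emeasure_mixture) (auto simp: sets_gaussian_iso label_shift_def)
  also have "\<dots> = (\<integral>\<^sup>+x. sample_lr d \<alpha> \<epsilon> v x * indicator A x \<partial>?N)"
    unfolding e using assms A[of "\<lambda>_. 0"]
    by (simp add: sample_lr_def UNIV_bool prob_label_def ennreal_mult' lr_nonneg
        nn_integral_add nn_integral_cmult distrib_right mult.assoc)
  also have "\<dots> = emeasure (density ?N (sample_lr d \<alpha> \<epsilon> v)) A"
    using A by (simp add: emeasure_density)
  finally show "emeasure (sample_mixture d \<alpha> \<epsilon> v) A = emeasure (density ?N (sample_lr d \<alpha> \<epsilon> v)) A" .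
qed

text \<open>The likelihood ratio of the whole sample given both \<open>v\<close> and the labeling
  \<open>b\<close>.\<close>

definition labeled_lr ::
    "nat \<Rightarrow> nat \<Rightarrow> real \<Rightarrow> real \<Rightarrow> (nat \<Rightarrow> bool) \<Rightarrow> (nat \<Rightarrow> real) \<Rightarrow> (nat \<Rightarrow> nat \<Rightarrow> real) \<Rightarrow> real" where
  "labeled_lr d n \<alpha> \<epsilon> b v X = (\<Prod>i<n. lr d (\<lambda>j. label_shift \<alpha> \<epsilon> (b i) * v j) (X i))"

lemma labeled_lr_nonneg: "0 \<le> labeled_lr d n \<alpha> \<epsilon> b v X"
  by (simp add: labeled_lr_def prod_nonneg lr_nonneg)

text \<open>Expanding the product over samples of the sums over labels gives a sum over labelings,
  so a product of mixtures is a mixture of products. This exposes the labels to truncation.\<close>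

lemma iid_sample_mixture_eq_density:
  assumes "0 \<le> \<epsilon>" "\<epsilon> \<le> 1"
  shows "iid n (sample_mixture d \<alpha> \<epsilon> v) =
    density (null_dist d n) (\<lambda>X. \<Sum>b\<in>labelings n. ennreal (weight n \<epsilon> b * labeled_lr d n \<alpha> \<epsilon> b v X))"
proof -
  have "prob_space (sample_mixture d \<alpha> \<epsilon> v)"
    unfolding sample_mixture_def using assms
    by (intro prob_space_mixture prob_space_gaussian_iso) (auto simp: sets_gaussian_iso)
  then have "sigma_finite_measure (density (gaussian_iso d (\<lambda>_. 0) 1) (sample_lr d \<alpha> \<epsilon> v))"
    unfolding sample_mixture_eq_density[OF assms] by (rule prob_space_imp_sigma_finite)
  then have "iid n (sample_mixture d \<alpha> \<epsilon> v) =
      density (null_dist d n) (\<lambda>X. \<Prod>i<n. sample_lr d \<alpha> \<epsilon> v (X i))"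
    unfolding sample_mixture_eq_density[OF assms] iid_def null_dist_def
    by (intro PiM_density borel_measurable_sample_lr
        prob_space_imp_sigma_finite[OF prob_space_gaussian_iso]) auto
  moreover have "(\<Prod>i<n. sample_lr d \<alpha> \<epsilon> v (X i)) =
      (\<Sum>b\<in>labelings n. ennreal (weight n \<epsilon> b * labeled_lr d n \<alpha> \<epsilon> b v X))" for X
  proof -
    have p: "0 \<le> prob_label \<epsilon> b" for b using assms by (simp add: prob_label_def)
    show ?thesis
      unfolding sample_lr_def
      by (subst prod_sum_PiE)
        (auto simp: prod_ennreal lr_nonneg p weight_def labeled_lr_def prod.distrib)
  qed
  ultimately show ?thesis by simp
qed

lemma measurable_labeled_lr:
  assumes "0 < s" "f \<in> N \<rightarrow>\<^sub>M gaussian_iso d \<mu> s" "g \<in> N \<rightarrow>\<^sub>M null_dist d n"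
  shows "(\<lambda>x. labeled_lr d n \<alpha> \<epsilon> b (f x) (g x)) \<in> borel_measurable N"
proof -
  have f: "(\<lambda>x. f x j) \<in> borel_measurable N" if "j < d" for j
    using measurable_compose[OF assms(2) measurable_gaussian_iso_component[OF assms(1) that]] .
  have g: "(\<lambda>x. g x i j) \<in> borel_measurable N" if "i < n" "j < d" for i j
  proof -
    have "(\<lambda>x. g x i) \<in> N \<rightarrow>\<^sub>M gaussian_iso d (\<lambda>_. 0) 1"
      using assms(3) that(1) unfolding null_dist_def iid_def
      by (auto intro: measurable_compose measurable_component_singleton)
    from measurable_compose[OF this measurable_gaussian_iso_component[OF zero_less_one that(2)]]
    show ?thesis .
  qed
  show ?thesis
    unfolding labeled_lr_def lr_def
    by (intro borel_measurable_prod measurable_compose[OF _ borel_measurable_exp]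
        borel_measurable_diff borel_measurable_times borel_measurable_const borel_measurable_divide
        borel_measurable_power f g) auto
qed

text \<open>In each coordinate the exponents add up to
  \<open>(m + k) * x - (m\<^sup>2 + k\<^sup>2) / 2\<close>; the Gaussian integral adds
  \<open>(m + k)\<^sup>2 / 2\<close>, and only the cross term \<open>m * k\<close> is left.\<close>

lemma nn_integral_lr_mult_lr:
  "(\<integral>\<^sup>+x. ennreal (lr d \<mu> x * lr d \<nu> x) \<partial>gaussian_iso d (\<lambda>_. 0) 1) =
    ennreal (exp (\<Sum>j<d. \<mu> j * \<nu> j))"
proof -
  have one: "(\<integral>\<^sup>+x. ennreal (exp (m * x - m\<^sup>2 / 2) * exp (k * x - k\<^sup>2 / 2))
      \<partial>density lborel std_normal_density) = ennreal (exp (m * k))" for m k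
  proof -
    have "exp (m * x - m\<^sup>2 / 2) * exp (k * x - k\<^sup>2 / 2) = exp (- (m\<^sup>2 + k\<^sup>2) / 2) * exp ((m + k) * x)" for x
      by (simp add: field_simps flip: exp_add)
    then have "(\<integral>\<^sup>+x. ennreal (exp (m * x - m\<^sup>2 / 2) * exp (k * x - k\<^sup>2 / 2))
        \<partial>density lborel std_normal_density) = ennreal (exp (- (m\<^sup>2 + k\<^sup>2) / 2)) * ennreal (exp ((m + k)\<^sup>2 / 2))"
      using nn_integral_normal_exp_linear[of 1 "m + k"]
      by (simp add: ennreal_mult nn_integral_cmult)
    also have "\<dots> = ennreal (exp (m * k))"
      by (simp add: field_simps power2_eq_square flip: exp_add ennreal_mult)
    finally show ?thesis .
  qed
  have "(\<integral>\<^sup>+x. ennreal (lr d \<mu> x * lr d \<nu> x) \<partial>gaussian_iso d (\<lambda>_. 0) 1) =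
      (\<integral>\<^sup>+x. (\<Prod>j<d. ennreal (exp (\<mu> j * x j - (\<mu> j)\<^sup>2 / 2) * exp (\<nu> j * x j - (\<nu> j)\<^sup>2 / 2)))
        \<partial>gaussian_iso d (\<lambda>_. 0) 1)"
    by (simp add: lr_def prod_ennreal prod.distrib)
  also have "\<dots> = (\<Prod>j<d. ennreal (exp (\<mu> j * \<nu> j)))"
    by (subst nn_integral_gaussian_iso_prod[where f="\<lambda>j y.
          ennreal (exp (\<mu> j * y - (\<mu> j)\<^sup>2 / 2) * exp (\<nu> j * y - (\<nu> j)\<^sup>2 / 2))"])
      (auto simp: one)
  also have "\<dots> = ennreal (exp (\<Sum>j<d. \<mu> j * \<nu> j))"
    by (simp add: prod_ennreal exp_sum)
  finally show ?thesis .
qed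

lemma nn_integral_null_dist_prod:
  assumes "\<And>i. i < n \<Longrightarrow> f i \<in> borel_measurable (gaussian_iso d (\<lambda>_. 0) 1)"
  shows "(\<integral>\<^sup>+X. (\<Prod>i<n. f i (X i)) \<partial>null_dist d n) =
    (\<Prod>i<n. \<integral>\<^sup>+x. f i x \<partial>gaussian_iso d (\<lambda>_. 0) 1)"
proof -
  interpret product_sigma_finite "\<lambda>i::nat. gaussian_iso d (\<lambda>_. 0) 1"
    unfolding product_sigma_finite_def
    using prob_space_imp_sigma_finite[OF prob_space_gaussian_iso, of 1] by simp
  show ?thesis
    unfolding null_dist_def iid_def using assms by (intro product_nn_integral_prod) auto
qed

text \<open>Sample \<open>i\<close> contributes the inner product of its two mean vectors, which is
  the product of the two shifts times that of \<open>v\<close> and \<open>w\<close>; summing over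
  \<open>i\<close> produces the overlap.\<close>

lemma nn_integral_labeled_lr_mult:
  "(\<integral>\<^sup>+X. ennreal (labeled_lr d n \<alpha> \<epsilon> a v X * labeled_lr d n \<alpha> \<epsilon> b w X) \<partial>null_dist d n) =
    ennreal (exp (overlap n \<alpha> \<epsilon> a b * (\<Sum>j<d. v j * w j)))"
proof -
  let ?L = "\<lambda>b v. lr d (\<lambda>j. label_shift \<alpha> \<epsilon> b * v j)"
  have "(\<integral>\<^sup>+X. ennreal (labeled_lr d n \<alpha> \<epsilon> a v X * labeled_lr d n \<alpha> \<epsilon> b w X) \<partial>null_dist d n) =
      (\<integral>\<^sup>+X. (\<Prod>i<n. ennreal (?L (a i) v (X i) * ?L (b i) w (X i))) \<partial>null_dist d n)"
    by (simp add: labeled_lr_def prod_ennreal lr_nonneg prod.distrib)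
  also have "\<dots> = (\<Prod>i<n. \<integral>\<^sup>+x. ennreal (?L (a i) v x * ?L (b i) w x) \<partial>gaussian_iso d (\<lambda>_. 0) 1)"
    using borel_measurable_lr
    by (intro nn_integral_null_dist_prod[where f="\<lambda>i x. ennreal (?L (a i) v x * ?L (b i) w x)"]) auto
  also have "\<dots> = ennreal (exp (\<Sum>i<n. \<Sum>j<d. label_shift \<alpha> \<epsilon> (a i) * v j * (label_shift \<alpha> \<epsilon> (b i) * w j)))"
    by (simp add: nn_integral_lr_mult_lr prod_ennreal exp_sum prod_nonneg)
  also have "(\<Sum>i<n. \<Sum>j<d. label_shift \<alpha> \<epsilon> (a i) * v j * (label_shift \<alpha> \<epsilon> (b i) * w j)) =
      overlap n \<alpha> \<epsilon> a b * (\<Sum>j<d. v j * w j)"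
    unfolding overlap_def sum_product by (intro sum.cong refl) simp
  finally show ?thesis .
qed

lemma nn_integral_labeled_lr:
  "(\<integral>\<^sup>+X. ennreal (labeled_lr d n \<alpha> \<epsilon> b v X) \<partial>null_dist d n) = 1"
proof -
  \<comment> \<open>With zero mean vectors the planted and null laws agree, so the total mass is the
    cross moment with \<open>w = 0\<close>.\<close>
  have "labeled_lr d n \<alpha> \<epsilon> b (\<lambda>_. 0) X = 1" for X
    by (simp add: labeled_lr_def lr_def)
  then show ?thesis
    using nn_integral_labeled_lr_mult[of d n \<alpha> \<epsilon> b v b "\<lambda>_. 0"] by simp
qed

section \<open>Averaging over the hidden vector and truncating the labelings\<close>

definition averaged_lr ::
    "nat \<Rightarrow> nat \<Rightarrow> real \<Rightarrow> real \<Rightarrow> (nat \<Rightarrow> bool) \<Rightarrow> (nat \<Rightarrow> nat \<Rightarrow> real) \<Rightarrow> ennreal" where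
  "averaged_lr d n \<alpha> \<epsilon> b X =
    (\<integral>\<^sup>+v. ennreal (labeled_lr d n \<alpha> \<epsilon> b v X) \<partial>gaussian_iso d (\<lambda>_. 0) (1 / real d))"

context
  fixes d :: nat
  assumes d: "1 \<le> d"
begin

private abbreviation "V \<equiv> gaussian_iso d (\<lambda>_. 0) (1 / real d)"

private lemma s: "0 < 1 / real d" using d by simp

private lemma V: "prob_space V" using s by (rule prob_space_gaussian_iso)

private lemma sigma_finite_V: "sigma_finite_measure V"
  using V by (rule prob_space_imp_sigma_finite)

private lemma sigma_finite_null: "sigma_finite_measure (null_dist d n)"
  using prob_space_null_dist by (rule prob_space_imp_sigma_finite)

private lemma pair: "pair_sigma_finite V (null_dist d n)"
  using sigma_finite_V sigma_finite_null by (simp add: pair_sigma_finite_def)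

private lemmas [measurable] = measurable_labeled_lr[OF s]

lemma measurable_averaged_lr: "averaged_lr d n \<alpha> \<epsilon> b \<in> borel_measurable (null_dist d n)"
  unfolding averaged_lr_def[abs_def]
  by (rule sigma_finite_measure.borel_measurable_nn_integral[OF sigma_finite_V]) measurable

lemma set_nn_integral_averaged_lr:
  assumes [measurable]: "A \<in> sets (null_dist d n)"
  shows "(\<integral>\<^sup>+X\<in>A. averaged_lr d n \<alpha> \<epsilon> b X \<partial>null_dist d n) =
    (\<integral>\<^sup>+v. (\<integral>\<^sup>+X\<in>A. ennreal (labeled_lr d n \<alpha> \<epsilon> b v X) \<partial>null_dist d n) \<partial>V)"
proof -
  have "(\<integral>\<^sup>+X\<in>A. averaged_lr d n \<alpha> \<epsilon> b X \<partial>null_dist d n) =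
      (\<integral>\<^sup>+X. (\<integral>\<^sup>+v. ennreal (labeled_lr d n \<alpha> \<epsilon> b v X) * indicator A X \<partial>V) \<partial>null_dist d n)"
    unfolding averaged_lr_def by (intro nn_integral_cong nn_integral_multc[symmetric]) measurable
  also have "\<dots> = (\<integral>\<^sup>+v. (\<integral>\<^sup>+X\<in>A. ennreal (labeled_lr d n \<alpha> \<epsilon> b v X) \<partial>null_dist d n) \<partial>V)"
    by (rule pair_sigma_finite.Fubini'[OF pair]) measurable
  finally show ?thesis .
qed

lemma nn_integral_averaged_lr: "(\<integral>\<^sup>+X. averaged_lr d n \<alpha> \<epsilon> b X \<partial>null_dist d n) = 1"
proof -
  have "(\<integral>\<^sup>+X. averaged_lr d n \<alpha> \<epsilon> b X \<partial>null_dist d n) =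
      (\<integral>\<^sup>+v. (\<integral>\<^sup>+X. ennreal (labeled_lr d n \<alpha> \<epsilon> b v X) \<partial>null_dist d n) \<partial>V)"
    unfolding averaged_lr_def by (rule pair_sigma_finite.Fubini'[OF pair]) measurable
  then show ?thesis
    by (simp add: nn_integral_labeled_lr prob_space.emeasure_space_1[OF V])
qed

text \<open>The product of two averages is a double integral over independent copies
  \<open>v\<close> and \<open>w\<close>. Tonelli makes the integral over \<open>X\<close> innermost,
  where it is the explicit cross moment, and the Gaussian bilinear bound finishes.\<close>

lemma nn_integral_averaged_lr_mult_le:
  assumes "\<bar>overlap n \<alpha> \<epsilon> a b\<bar> \<le> real d / 2"
  shows "(\<integral>\<^sup>+X. averaged_lr d n \<alpha> \<epsilon> a X * averaged_lr d n \<alpha> \<epsilon> b X \<partial>null_dist d n) \<le>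
    ennreal (exp ((overlap n \<alpha> \<epsilon> a b)\<^sup>2 / real d))"
proof -
  let ?L = "labeled_lr d n \<alpha> \<epsilon>"
  interpret V: sigma_finite_measure V by (rule sigma_finite_V)
  have "averaged_lr d n \<alpha> \<epsilon> a X * averaged_lr d n \<alpha> \<epsilon> b X =
      (\<integral>\<^sup>+v. (\<integral>\<^sup>+w. ennreal (?L a v X * ?L b w X) \<partial>V) \<partial>V)"
    if [measurable]: "X \<in> space (null_dist d n)" for X
    unfolding averaged_lr_def
    by (simp add: nn_integral_multc nn_integral_cmult ennreal_mult labeled_lr_nonneg)
  then have "(\<integral>\<^sup>+X. averaged_lr d n \<alpha> \<epsilon> a X * averaged_lr d n \<alpha> \<epsilon> b X \<partial>null_dist d n) =
      (\<integral>\<^sup>+X. (\<integral>\<^sup>+v. (\<integral>\<^sup>+w. ennreal (?L a v X * ?L b w X) \<partial>V) \<partial>V) \<partial>null_dist d n)"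
    by (rule nn_integral_cong)
  also have "\<dots> = (\<integral>\<^sup>+v. (\<integral>\<^sup>+X. (\<integral>\<^sup>+w. ennreal (?L a v X * ?L b w X) \<partial>V) \<partial>null_dist d n) \<partial>V)"
    by (rule pair_sigma_finite.Fubini'[OF pair]) measurable
  also have "\<dots> = (\<integral>\<^sup>+v. (\<integral>\<^sup>+w. (\<integral>\<^sup>+X. ennreal (?L a v X * ?L b w X) \<partial>null_dist d n) \<partial>V) \<partial>V)"
    by (intro nn_integral_cong pair_sigma_finite.Fubini'[OF pair]) measurable
  also have "\<dots> = (\<integral>\<^sup>+v. (\<integral>\<^sup>+w. ennreal (exp (overlap n \<alpha> \<epsilon> a b * (\<Sum>j<d. v j * w j))) \<partial>V) \<partial>V)"
    by (simp add: nn_integral_labeled_lr_mult)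
  also have "\<dots> \<le> ennreal (exp ((overlap n \<alpha> \<epsilon> a b)\<^sup>2 / real d))"
    using d assms by (rule nn_integral_gaussian_exp_inner)
  finally show ?thesis .
qed

text \<open>Restricting to \<open>T\<close> drops nonnegative terms of the full labeling sum; by
  Tonelli that full sum is the planted law, the integral over \<open>v\<close> of the conditional
  laws.\<close>

lemma truncated_lr_le_planted_dist:
  assumes "0 \<le> \<epsilon>" "\<epsilon> \<le> 1" and T: "T \<subseteq> labelings n" and A[measurable]: "A \<in> sets (null_dist d n)"
  shows "(\<integral>\<^sup>+X\<in>A. (\<Sum>b\<in>T. ennreal (weight n \<epsilon> b) * averaged_lr d n \<alpha> \<epsilon> b X) \<partial>null_dist d n) \<le>
    emeasure (planted_dist d n \<alpha> \<epsilon>) A"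
proof -
  let ?L = "labeled_lr d n \<alpha> \<epsilon>" and ?w = "weight n \<epsilon>"
  have w: "0 \<le> ?w b" for b using assms by (intro weight_nonneg)
  note [measurable] = measurable_averaged_lr
  interpret N: sigma_finite_measure "null_dist d n" by (rule sigma_finite_null)
  have "(\<integral>\<^sup>+X\<in>A. (\<Sum>b\<in>T. ennreal (?w b) * averaged_lr d n \<alpha> \<epsilon> b X) \<partial>null_dist d n) =
      (\<Sum>b\<in>T. ennreal (?w b) * (\<integral>\<^sup>+X\<in>A. averaged_lr d n \<alpha> \<epsilon> b X \<partial>null_dist d n))"
    by (simp add: sum_distrib_right nn_integral_sum nn_integral_cmult mult.assoc)
  also have "\<dots> \<le> (\<Sum>b\<in>labelings n. ennreal (?w b) * (\<integral>\<^sup>+X\<in>A. averaged_lr d n \<alpha> \<epsilon> b X \<partial>null_dist d n))"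
    by (intro sum_mono2 finite_labelings T) auto
  also have "\<dots> = (\<integral>\<^sup>+v. (\<Sum>b\<in>labelings n. ennreal (?w b) *
      (\<integral>\<^sup>+X\<in>A. ennreal (?L b v X) \<partial>null_dist d n)) \<partial>V)"
    by (simp add: set_nn_integral_averaged_lr nn_integral_sum nn_integral_cmult)
  also have "\<dots> = (\<integral>\<^sup>+v. emeasure (iid n (sample_mixture d \<alpha> \<epsilon> v)) A \<partial>V)"
  proof (intro nn_integral_cong)
    fix v assume [measurable]: "v \<in> space V"
    show "(\<Sum>b\<in>labelings n. ennreal (?w b) * (\<integral>\<^sup>+X\<in>A. ennreal (?L b v X) \<partial>null_dist d n)) =
        emeasure (iid n (sample_mixture d \<alpha> \<epsilon> v)) A"
      unfolding iid_sample_mixture_eq_density[OF assms(1,2)]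
      by (simp add: emeasure_density sum_distrib_right nn_integral_sum nn_integral_cmult mult.assoc
          ennreal_mult w labeled_lr_nonneg)
  qed
  also have "\<dots> = emeasure (planted_dist d n \<alpha> \<epsilon>) A"
    using d assms by (intro emeasure_planted_dist[symmetric])
  finally show ?thesis .
qed

lemma truncated_lr_mass:
  assumes "0 \<le> \<epsilon>" "\<epsilon> \<le> 1"
  shows "(\<integral>\<^sup>+X. (\<Sum>b\<in>T. ennreal (weight n \<epsilon> b) * averaged_lr d n \<alpha> \<epsilon> b X) \<partial>null_dist d n) =
    ennreal (\<Sum>b\<in>T. weight n \<epsilon> b)"
  using measurable_averaged_lr weight_nonneg[OF assms]
  by (simp add: nn_integral_sum nn_integral_cmult nn_integral_averaged_lr)

lemma truncated_lr_second_moment_le: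
  assumes "0 \<le> \<epsilon>" "\<epsilon> \<le> 1"
    and overlap: "\<And>a b. a \<in> T \<Longrightarrow> b \<in> T \<Longrightarrow> \<bar>overlap n \<alpha> \<epsilon> a b\<bar> \<le> real d / 2"
  shows "(\<integral>\<^sup>+X. (\<Sum>b\<in>T. ennreal (weight n \<epsilon> b) * averaged_lr d n \<alpha> \<epsilon> b X)\<^sup>2 \<partial>null_dist d n) \<le>
    ennreal (\<Sum>a\<in>T. \<Sum>b\<in>T. weight n \<epsilon> a * weight n \<epsilon> b *
      exp ((overlap n \<alpha> \<epsilon> a b)\<^sup>2 / real d))"
proof -
  let ?w = "weight n \<epsilon>" and ?f = "averaged_lr d n \<alpha> \<epsilon>"
  note [measurable] = measurable_averaged_lr
  have w: "0 \<le> ?w b" for b using assms(1,2) by (rule weight_nonneg)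
  have "(\<Sum>b\<in>T. ennreal (?w b) * ?f b X)\<^sup>2 =
      (\<Sum>a\<in>T. \<Sum>b\<in>T. ennreal (?w a * ?w b) * (?f a X * ?f b X))" for X
    by (simp add: power2_eq_square sum_product ennreal_mult w ac_simps)
  then have "(\<integral>\<^sup>+X. (\<Sum>b\<in>T. ennreal (?w b) * ?f b X)\<^sup>2 \<partial>null_dist d n) =
      (\<Sum>a\<in>T. \<Sum>b\<in>T. ennreal (?w a * ?w b) * (\<integral>\<^sup>+X. ?f a X * ?f b X \<partial>null_dist d n))"
    by (simp add: nn_integral_sum nn_integral_cmult)
  also have "\<dots> \<le> (\<Sum>a\<in>T. \<Sum>b\<in>T. ennreal (?w a * ?w b) *
      ennreal (exp ((overlap n \<alpha> \<epsilon> a b)\<^sup>2 / real d)))"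
    using overlap by (intro sum_mono mult_left_mono nn_integral_averaged_lr_mult_le) auto
  also have "\<dots> = ennreal (\<Sum>a\<in>T. \<Sum>b\<in>T. ?w a * ?w b * exp ((overlap n \<alpha> \<epsilon> a b)\<^sup>2 / real d))"
    by (simp add: w sum_nonneg flip: ennreal_mult)
  finally show ?thesis .
qed

end

section \<open>Choice of the constant\<close>

text \<open>The truncated second moment bound is applied to typical labelings with
  \<open>\<delta> = 1 / 10000\<close>, \<open>\<eta> = 1 / 1000\<close> and window slack
  \<open>r = 100\<close>; the resulting root of \<open>0.0012\<close> is below
  \<open>0.1\<close>.\<close>

lemma tv_dist_null_planted_le:
  assumes d: "1 \<le> d" and \<alpha>: "0 < \<alpha>" and \<epsilon>: "0 < \<epsilon>" "\<epsilon> < 1" "\<epsilon> \<le> \<alpha>"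
    and c: "0 < c" "c \<le> 1 / 10000"
    and n: "real n = c * (real d * \<epsilon> ^ 3 / \<alpha> ^ 4)"
    and large: "sqrt (real d) / \<alpha> ^ 2 \<le> c * (real d * \<epsilon> ^ 3 / \<alpha> ^ 4)"
  shows "tv_dist (null_dist d n) (planted_dist d n \<alpha> \<epsilon>) \<le> 1 / 10"
proof -
  let ?T = "typical n \<epsilon>" and ?w = "weight n \<epsilon>"
  define f where "f X = (\<Sum>b\<in>?T. ennreal (?w b) * averaged_lr d n \<alpha> \<epsilon> b X)" for X
  define Q where "Q = (\<Sum>a\<in>?T. \<Sum>b\<in>?T. ?w a * ?w b * exp ((overlap n \<alpha> \<epsilon> a b)\<^sup>2 / real d))"
  have \<epsilon>': "0 \<le> \<epsilon>" "\<epsilon> \<le> 1" using \<epsilon> by auto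
  have sd: "0 < sqrt (real d)" "sqrt (real d) * sqrt (real d) = real d" using d by auto
  \<comment> \<open>This is \<open>large\<close> multiplied by \<open>\<alpha>\<^sup>2 / d\<close>.
    It makes the tilt \<open>sqrt (2 / d)\<close> small compared with
    \<open>\<epsilon>\<^sup>2 / \<alpha>\<^sup>2\<close>.\<close>
  have sqrt_d: "1 / sqrt (real d) \<le> c * \<epsilon> ^ 3 / \<alpha>\<^sup>2"
  proof -
    have "sqrt (real d) / \<alpha>\<^sup>2 * (\<alpha>\<^sup>2 / real d) \<le> c * (real d * \<epsilon> ^ 3 / \<alpha> ^ 4) * (\<alpha>\<^sup>2 / real d)"
      using large by (rule mult_right_mono) simp
    moreover have "sqrt (real d) / \<alpha>\<^sup>2 * (\<alpha>\<^sup>2 / real d) = 1 / sqrt (real d)"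
      using \<alpha> sd by (simp add: field_simps)
    moreover have "c * (real d * \<epsilon> ^ 3 / \<alpha> ^ 4) * (\<alpha>\<^sup>2 / real d) = c * \<epsilon> ^ 3 / \<alpha>\<^sup>2"
      using \<alpha> d by (simp add: field_simps power2_eq_square power4_eq_xxxx)
    ultimately show ?thesis by simp
  qed
  \<comment> \<open>Multiplying \<open>sqrt_d\<close> by
    \<open>sqrt d / \<alpha>\<^sup>2 \<le> n\<close> cancels both \<open>d\<close> and
    \<open>\<alpha>\<close>. The expected number of minority labels is thus large.\<close>
  have \<epsilon>n: "1 / c \<le> \<epsilon> * real n"
  proof -
    have "1 / sqrt (real d) * (sqrt (real d) / \<alpha>\<^sup>2) \<le> c * \<epsilon> ^ 3 / \<alpha>\<^sup>2 * real n"
      using sqrt_d large n c \<epsilon> by (intro mult_mono) auto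
    then have "1 \<le> c * \<epsilon> ^ 3 * real n"
      using \<alpha> sd by (simp add: field_simps)
    also have "\<dots> \<le> c * \<epsilon> ^ 1 * real n"
      using \<epsilon> c by (intro mult_right_mono mult_left_mono power_decreasing) auto
    finally show ?thesis using c by (simp add: field_simps)
  qed
  \<comment> \<open>The bound for typical overlaps in terms of \<open>d\<close>. Since
    \<open>\<epsilon> \<le> \<alpha>\<close>, it is at most \<open>4 * c * d\<close>, well below
    \<open>d / 2\<close>.\<close>
  have B: "4 * \<alpha>\<^sup>2 * real n / \<epsilon> = 4 * c * real d * (\<epsilon>\<^sup>2 / \<alpha>\<^sup>2)"
    using \<alpha> \<epsilon> by (simp add: n field_simps power2_eq_square power3_eq_cube power4_eq_xxxx)
  have ratio: "\<epsilon>\<^sup>2 / \<alpha>\<^sup>2 \<le> 1" using \<alpha> \<epsilon> by (simp add: power_mono)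
  have overlap: "\<bar>overlap n \<alpha> \<epsilon> a b\<bar> \<le> real d / 2" if "a \<in> ?T" "b \<in> ?T" for a b
  proof -
    have "\<bar>overlap n \<alpha> \<epsilon> a b\<bar> \<le> 4 * c * real d * (\<epsilon>\<^sup>2 / \<alpha>\<^sup>2)"
      using abs_overlap_le[OF \<epsilon>(1,2) that, of \<alpha>] unfolding B .
    also have "\<dots> \<le> 4 * c * real d * 1" using c ratio by (intro mult_left_mono) auto
    also have "\<dots> \<le> 4 * (1 / 10000) * real d"
      unfolding mult_1_right using c by (intro mult_right_mono) auto
    finally show ?thesis by simp
  qed
  \<comment> \<open>The overlap part contributes \<open>8 * c\<close> and the slack 100 contributes
    \<open>200 * c\<close>, each times \<open>\<epsilon>\<^sup>2 / \<alpha>\<^sup>2\<close>; so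
    \<open>208 * c \<le> 1\<close> suffices.\<close>
  have window: "sqrt (2 / real d) * (sqrt (2 / real d) * (4 * \<alpha>\<^sup>2 * real n / \<epsilon>) + 100) \<le> \<epsilon>\<^sup>2 / \<alpha>\<^sup>2"
  proof -
    have "sqrt 2 \<le> 2" by (rule real_le_lsqrt) auto
    then have "sqrt (2 / real d) \<le> 2 * (1 / sqrt (real d))"
      using sd by (simp add: real_sqrt_divide divide_right_mono)
    also have "\<dots> \<le> 2 * (c * \<epsilon> ^ 3 / \<alpha>\<^sup>2)" using sqrt_d by simp
    also have "\<dots> \<le> 2 * (c * \<epsilon>\<^sup>2 / \<alpha>\<^sup>2)"
      using \<epsilon> c by (intro mult_left_mono divide_right_mono power_decreasing) auto
    finally have t: "sqrt (2 / real d) \<le> 2 * c * (\<epsilon>\<^sup>2 / \<alpha>\<^sup>2)" by simp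
    have "sqrt (2 / real d) * (sqrt (2 / real d) * (4 * \<alpha>\<^sup>2 * real n / \<epsilon>) + 100) =
        (sqrt (2 / real d))\<^sup>2 * (4 * c * real d * (\<epsilon>\<^sup>2 / \<alpha>\<^sup>2)) + 100 * sqrt (2 / real d)"
      unfolding B by (simp add: power2_eq_square algebra_simps)
    also have "\<dots> = 8 * c * (\<epsilon>\<^sup>2 / \<alpha>\<^sup>2) + 100 * sqrt (2 / real d)"
      using d by simp
    also have "\<dots> \<le> 8 * c * (\<epsilon>\<^sup>2 / \<alpha>\<^sup>2) + 100 * (2 * c * (\<epsilon>\<^sup>2 / \<alpha>\<^sup>2))"
      using t by (intro add_left_mono mult_left_mono) auto
    also have "\<dots> = (208 * c) * (\<epsilon>\<^sup>2 / \<alpha>\<^sup>2)" by (simp add: algebra_simps)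
    also have "\<dots> \<le> 1 * (\<epsilon>\<^sup>2 / \<alpha>\<^sup>2)" using c by (intro mult_right_mono) auto
    finally show ?thesis by simp
  qed
  \<comment> \<open>Up to a constant this is the variance bound for the overlap divided by
    \<open>d\<close>; its smallness brings the second moment close to 1.\<close>
  have k: "real n * \<alpha> ^ 4 / (real d * \<epsilon>\<^sup>2) = c * \<epsilon>"
    using \<alpha> \<epsilon> d by (simp add: n field_simps power2_eq_square power3_eq_cube)
  have c\<epsilon>: "0 \<le> c * \<epsilon>" "c * \<epsilon> \<le> 1 / 10000"
    using c \<epsilon> mult_mono[of c "1 / 10000" \<epsilon> 1] by auto
  have "(1 - 1 / 100\<^sup>2) * Q \<le> 1 / sqrt (1 - 4 * (c * \<epsilon>))"
    unfolding Q_def using sum_typical_exp_overlap_square_le[OF \<alpha> \<epsilon>(1,2) d _ window] c\<epsilon> unfolding k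
    by simp
  also have "\<dots> \<le> 1 + 4 * (c * \<epsilon>)" using c\<epsilon> by (intro inverse_sqrt_le_linear) auto
  finally have Q: "Q \<le> 1 + 1 / 1000" using c\<epsilon> by (simp add: power2_eq_square)
  \<comment> \<open>Here \<open>\<epsilon> * n\<close> is at least 10000, so
    \<open>exp x \<ge> 1 + x\<close> already bounds the discarded mass.\<close>
  have mass: "1 - 1 / 10000 \<le> (\<Sum>b\<in>?T. ?w b)"
  proof -
    have "10000 \<le> 1 / c" using c by (simp add: field_simps)
    then have "10000 \<le> exp (\<epsilon> * real n)"
      using \<epsilon>n exp_ge_add_one_self[of "\<epsilon> * real n"] by linarith
    then have "exp (- \<epsilon> * real n) \<le> 1 / 10000" by (simp add: exp_minus field_simps)
    then show ?thesis using sum_weight_typical[OF \<epsilon>', of n] by linarith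
  qed
  have "tv_dist (null_dist d n) (planted_dist d n \<alpha> \<epsilon>) \<le> sqrt (2 * (1 / 10000) + 1 / 1000)"
  proof (rule tv_dist_le_truncated_second_moment)
    show "prob_space (null_dist d n)" by (rule prob_space_null_dist)
    show "prob_space (planted_dist d n \<alpha> \<epsilon>)" using d \<epsilon>' by (rule prob_space_planted_dist)
    show "sets (planted_dist d n \<alpha> \<epsilon>) = sets (null_dist d n)" using d \<epsilon>' by (rule sets_planted_dist)
    show "f \<in> borel_measurable (null_dist d n)"
      unfolding f_def[abs_def] using measurable_averaged_lr[OF d] by measurable
    show "(\<integral>\<^sup>+X\<in>A. f X \<partial>null_dist d n) \<le> emeasure (planted_dist d n \<alpha> \<epsilon>) A"
      if "A \<in> sets (null_dist d n)" for A
      unfolding f_def using d \<epsilon>' typical_subset that by (rule truncated_lr_le_planted_dist)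
    show "ennreal (1 - 1 / 10000) \<le> (\<integral>\<^sup>+X. f X \<partial>null_dist d n)"
      unfolding f_def truncated_lr_mass[OF d \<epsilon>'] using mass by (rule ennreal_leI)
    have "(\<integral>\<^sup>+X. (f X)\<^sup>2 \<partial>null_dist d n) \<le> ennreal Q"
      unfolding f_def Q_def using d \<epsilon>' overlap by (rule truncated_lr_second_moment_le)
    also have "\<dots> \<le> ennreal (1 + 1 / 1000)" using Q by (rule ennreal_leI)
    finally show "(\<integral>\<^sup>+X. (f X)\<^sup>2 \<partial>null_dist d n) \<le> ennreal (1 + 1 / 1000)" .
  qed auto
  also have "\<dots> \<le> 1 / 10" by (rule real_le_lsqrt) (auto simp: power2_eq_square)
  finally show ?thesis .
qed

theorem theorem5p1:
  shows "\<exists>c::real. 0 < c \<and>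
    (\<forall>(d::nat) (n::nat) (\<alpha>::real) (\<epsilon>::real).
      1 \<le> d \<longrightarrow> 0 < \<alpha> \<longrightarrow> \<alpha> < 1 \<longrightarrow> 0 < \<epsilon> \<longrightarrow> \<epsilon> < 1 \<longrightarrow>
      real n = c * (real d * \<epsilon> ^ 3 / \<alpha> ^ 4) \<longrightarrow>
      \<epsilon> \<le> \<alpha> \<longrightarrow>
      sqrt (real d) / \<alpha> ^ 2 \<le> c * (real d * \<epsilon> ^ 3 / \<alpha> ^ 4) \<longrightarrow>
      tv_dist (null_dist d n) (planted_dist d n \<alpha> \<epsilon>) \<le> 1 / 10)"
  \<comment> \<open>Every constant in \<open>(0, 1 / 10000]\<close> satisfies the bound; the right
    endpoint is the witness.\<close>
  by (intro exI[of _ "1 / 10000"] conjI allI impI tv_dist_null_planted_le[where c = "1 / 10000"])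
    auto

end
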